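(* Let $0<p<1$. Then $M_{\mathrm{par}}$ is bounded from $H^{p,*}_{\mathrm{par}}(\mathbb{R}^2)$ to $\mathcal{T}^{p,\infty}(\mathbb{R}^2)$; that is, there is a finite constant $C$ such that $\|M_{\mathrm{par}}f\|_{\mathcal{T}^{p,\infty}(\mathbb{R}^2)}\le C\|f\|_{H^{p,*}_{\mathrm{par}}(\mathbb{R}^2)}$ for all $f\in H^{p,*}_{\mathrm{par}}(\mathbb{R}^2)$.
   Context: Fix a nonnegative smooth bump function $\varphi$ on $\mathbb{R}$ with $\varphi\le 1$, $\varphi\equiv 1$ on $(1,2)$ and $\operatorname{supp}\varphi\subseteq(1/2,5/2)$. For $f\in L^1_{\mathrm{loc}}(\mathbb{R}^2)$ and $r>0$ let $$A_rf(x)=\int_{\mathbb{R}}f(x_1-t,x_2-t^2)\,\varphi(t/r)\,\frac{dt}{r},\qquad M_{\mathrm{par}}f(x)=\sup_{r>0}|A_rf(x)|,$$ which is understood for almost every $x=(x_1,x_2)\in\mathbb{R}^2$. A parabolic box is a set $Q=Q(z,\rho)=z+[-\rho,\rho]\times[-\rho^2,\rho^2]$ with $z\in\mathbb{R}^2$, $\rho>0$; its side length is $\rho_Q=\rho(Q)=\rho$. For $0<p\le1$ fix a positive integer $N_p\ge\lfloor 3(1/p-1)\rfloor$. A parabolic $(p,\infty)$-atom (supported in, or associated with, $Q$) is a bounded measurable function $a$ on $\mathbb{R}^2$ for which there is a parabolic box $Q$ with $\operatorname{supp}a\subset Q$, $\|a\|_{L^\infty(\mathbb{R}^2)}\le|Q|^{-1/p}$,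 and $\int_{\mathbb{R}^2}x^\beta a(x)\,dx=0$ for all $\beta=(\beta_1,\beta_2)\in\mathbb{N}^2$ (with $0\in\mathbb{N}$) with $|\beta|=\beta_1+\beta_2\le N_p$, where $x^\beta=x_1^{\beta_1}x_2^{\beta_2}$. The parabolic scale cost of $Q$ is $w_p(Q)=[\min\{1,\rho_Q\}]^{2p-2}$. $H^{p,*}_{\mathrm{par}}(\mathbb{R}^2)$ is the space of all $f\in L^1_{\mathrm{loc}}(\mathbb{R}^2)$ admitting a (finite or countable) representation $f=\sum_Q\lambda_Qa_Q$, converging in $L^1_{\mathrm{loc}}(\mathbb{R}^2)$, where each $a_Q$ is a parabolic $(p,\infty)$-atom supported in the parabolic box $Q$ and $\sum_Q|\lambda_Q|^pw_p(Q)<\infty$; $\|f\|_{H^{p,*}_{\mathrm{par}}}$ is the infimum of $\left(\sum_Q|\lambda_Q|^pw_p(Q)\right)^{1/p}$ over all such representations. For a parabolic box $Q=Q(z,\rho_Q)$ put $Q^*=Q(z,4\rho_Q)$, and for $R\ge\rho_Q$ define the tendril $T(Q,R)=Q^*+\{(t,t^2):|t|\le R\}$. A tendril cover of a measurable set $E\subseteq\mathbb{R}^2$ is a countable family $\{(\theta_i,T(Q_i,R_i))\}_{i\ge1}$ with $Q_i$ parabolic boxes, $\theta_i\ge0$, $R_i\ge\rho_{Q_i}$, such that $\mathbf{1}_E(x)\le\sum_{i\ge1}\theta_i\mathbf{1}_{T(Q_i,R_i)}(x)$ for almost every $x\in\mathbb{R}^2$. The $p$-tendril content of $E$ is $C_p(E)=\inf\sum_{i\ge1}\theta_i\rho_{Q_i}R_i^{2p}$,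 the infimum over all tendril covers of $E$. The weak tendril space $\mathcal{T}^{p,\infty}(\mathbb{R}^2)$ consists of all measurable $f$ on $\mathbb{R}^2$ with $\|f\|_{\mathcal{T}^{p,\infty}(\mathbb{R}^2)}^p:=\sup_{\alpha>0}\alpha^pC_p(\{|f|>\alpha\})<\infty$. *)

theory Defs
  imports "HOL-Analysis.Analysis"
begin

definition bump :: "(real \<Rightarrow> real) \<Rightarrow> bool" where
  "bump \<phi> \<longleftrightarrow>
     (\<forall>k. (deriv ^^ k) \<phi> differentiable_on UNIV) \<and>
     (\<forall>t. 0 \<le> \<phi> t \<and> \<phi> t \<le> 1) \<and>
     (\<forall>t\<in>{1<..<2}. \<phi> t = 1) \<and>
     closure (support_on UNIV \<phi>) \<subseteq> {1/2<..<5/2}"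

definition L1_loc :: "(real \<times> real \<Rightarrow> complex) set" where
  "L1_loc = {f. \<forall>K. compact K \<longrightarrow> set_integrable lebesgue K f}"

text \<open>
  For locally integrable \<open>f\<close> the integrand below is integrable for all \<open>r > 0\<close> simultaneously,
  for almost every \<open>x\<close>; on the exceptional null set the Bochner integral may take its default
  value 0. The integral is over \<open>lebesgue\<close> rather than \<open>lborel\<close> because the slices of a Lebesgue
  measurable \<open>f\<close> along the parabola need not be Borel.
\<close>
definition A_par ::
  "(real \<Rightarrow> real) \<Rightarrow> real \<Rightarrow> (real \<times> real \<Rightarrow> complex) \<Rightarrow> real \<times> real \<Rightarrow> complex" where
  "A_par \<phi> r f x =
     (LINT t|lebesgue. f (fst x - t, snd x - t\<^sup>2) * complex_of_real (\<phi> (t / r) / r))"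

definition M_par ::
  "(real \<Rightarrow> real) \<Rightarrow> (real \<times> real \<Rightarrow> complex) \<Rightarrow> real \<times> real \<Rightarrow> ereal" where
  "M_par \<phi> f x = (SUP r\<in>{0<..}. ereal (cmod (A_par \<phi> r f x)))"

definition pbox :: "real \<times> real \<Rightarrow> real \<Rightarrow> (real \<times> real) set" where
  "pbox z \<rho> = (+) z ` ({-\<rho>..\<rho>} \<times> {-(\<rho>\<^sup>2)..\<rho>\<^sup>2})"

text \<open>
  The parameter \<open>N\<close> is the order of vanishing moments, written \<open>N\<^sub>p\<close> in the mathematics.
  The almost-everywhere bound is the bound on the essential supremum norm.
\<close>
definition par_atom ::
  "real \<Rightarrow> nat \<Rightarrow> real \<times> real \<Rightarrow> real \<Rightarrow> (real \<times> real \<Rightarrow> complex) \<Rightarrow> bool" where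
  "par_atom p N z \<rho> a \<longleftrightarrow>
     a \<in> borel_measurable lebesgue \<and> bounded (range a) \<and>
     closure (support_on UNIV a) \<subseteq> pbox z \<rho> \<and>
     (AE x in lebesgue. cmod (a x) \<le> measure lebesgue (pbox z \<rho>) powr (- 1 / p)) \<and>
     (\<forall>\<beta>\<^sub>1 \<beta>\<^sub>2. \<beta>\<^sub>1 + \<beta>\<^sub>2 \<le> N \<longrightarrow>
        (LINT x|lebesgue. complex_of_real (fst x ^ \<beta>\<^sub>1 * snd x ^ \<beta>\<^sub>2) * a x) = 0)"

definition scale_cost :: "real \<Rightarrow> real \<Rightarrow> real" where
  "scale_cost p \<rho> = min 1 \<rho> powr (2 * p - 2)"

text \<open>
  Representations are sequences of coefficients, atoms and boxes; a finite sum is a sequence whose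
  coefficients vanish from some index on (the zero function is an atom for every box).
\<close>
definition atomic_rep ::
  "real \<Rightarrow> nat \<Rightarrow> (real \<times> real \<Rightarrow> complex) \<Rightarrow> (nat \<Rightarrow> complex) \<Rightarrow>
   (nat \<Rightarrow> real \<times> real \<Rightarrow> complex) \<Rightarrow> (nat \<Rightarrow> real \<times> real) \<Rightarrow> (nat \<Rightarrow> real) \<Rightarrow> bool" where
  "atomic_rep p N f c a z \<rho> \<longleftrightarrow>
     (\<forall>i. 0 < \<rho> i \<and> par_atom p N (z i) (\<rho> i) (a i)) \<and>
     summable (\<lambda>i. cmod (c i) powr p * scale_cost p (\<rho> i)) \<and>
     (\<forall>K. compact K \<longrightarrow>
        (\<lambda>n. LINT x:K|lebesgue. cmod (f x - (\<Sum>i<n. c i * a i x))) \<longlonglongrightarrow> 0)"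

definition H_par :: "real \<Rightarrow> nat \<Rightarrow> (real \<times> real \<Rightarrow> complex) set" where
  "H_par p N = {f \<in> L1_loc. \<exists>c a z \<rho>. atomic_rep p N f c a z \<rho>}"

definition H_par_norm :: "real \<Rightarrow> nat \<Rightarrow> (real \<times> real \<Rightarrow> complex) \<Rightarrow> real" where
  "H_par_norm p N f =
     Inf {(\<Sum>i. cmod (c i) powr p * scale_cost p (\<rho> i)) powr (1 / p) | c a z \<rho>.
            atomic_rep p N f c a z \<rho>}"

definition tendril :: "real \<times> real \<Rightarrow> real \<Rightarrow> real \<Rightarrow> (real \<times> real) set" where
  "tendril z \<rho> R = pbox z (4 * \<rho>) + {(t, t\<^sup>2) | t. \<bar>t\<bar> \<le> R}"

definition tendril_cover ::
  "(real \<times> real) set \<Rightarrow> (nat \<Rightarrow> real) \<Rightarrow> (nat \<Rightarrow> real \<times> real) \<Rightarrow> (nat \<Rightarrow> real) \<Rightarrow>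
   (nat \<Rightarrow> real) \<Rightarrow> bool" where
  "tendril_cover E \<theta> z \<rho> R \<longleftrightarrow>
     (\<forall>i. 0 \<le> \<theta> i \<and> 0 < \<rho> i \<and> \<rho> i \<le> R i) \<and>
     (AE x in lebesgue.
        indicator E x \<le> (\<Sum>i. ennreal (\<theta> i) * indicator (tendril (z i) (\<rho> i) (R i)) x))"

definition tendril_content :: "real \<Rightarrow> (real \<times> real) set \<Rightarrow> ennreal" where
  "tendril_content p E =
     Inf {(\<Sum>i. ennreal (\<theta> i * \<rho> i * R i powr (2 * p))) | \<theta> z \<rho> R. tendril_cover E \<theta> z \<rho> R}"

definition weak_tendril_sup :: "real \<Rightarrow> (real \<times> real \<Rightarrow> ereal) \<Rightarrow> ennreal" where
  "weak_tendril_sup p g =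
     (SUP \<alpha>\<in>{0<..}. ennreal (\<alpha> powr p) * tendril_content p {x. \<bar>g x\<bar> > ereal \<alpha>})"

definition weak_tendril_space :: "real \<Rightarrow> (real \<times> real \<Rightarrow> ereal) set" where
  "weak_tendril_space p = {g \<in> borel_measurable lebesgue. weak_tendril_sup p g < \<infinity>}"

text \<open>Only meaningful on \<open>weak_tendril_space\<close>: \<open>enn2real\<close> sends an infinite supremum to 0.\<close>
definition weak_tendril_norm :: "real \<Rightarrow> (real \<times> real \<Rightarrow> ereal) \<Rightarrow> real" where
  "weak_tendril_norm p g = enn2real (weak_tendril_sup p g) powr (1 / p)"

end

(* Along the parabola the average A_r a of an atom on a box Q of side rho is at most a constant times
   |Q|^(-1/p) min(1, (rho/r)^2), and it vanishes off the tendrils of length at least 5r/2. For fixed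
   x and r with |A_r f(x)| > alpha one has 1 <= sum_i min(1, |c_i| |A_r a_i(x)| / alpha), and the
   i-th summand is dominated by a geometric series of tendrils of lengths 2^k R_i with weights
   4^(-k), where R_i is the scale at which the decay estimate reaches alpha. Since p < 1, the
   resulting fractional cover costs at most a constant times alpha^(-p) sum_i |c_i|^p rho_i^(2p-2). *)
theory Submission
  imports Defs
begin

subsection \<open>Measurability and bump functions\<close>

text \<open>Domination of |A_r f(x)| by the sum of |c_i| |A_r a_i(x)| is a pointwise claim, while
  the atomic series converges only in \<open>L1_loc\<close> and a parabola is a null set of the
  plane. Tonelli bridges the gap: for fixed t, subtracting (t, t^2) is a translation of the plane,
  so a double integral over x and t splits into a product. Partial sums whose errors on growing
  boxes are summable therefore converge in L^1 on every bounded arc of almost every translated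
  parabola. All arcs are treated together, which leaves one exceptional null set for all radii r.
  Tonelli is applied to Borel functions, so \<open>f\<close> and the atoms are first replaced by
  Borel representatives; almost every slice is unaffected. The supremum over r costs nothing in the
  cover, because the tendrils attached to an atom depend on c_i, rho_i and alpha but not on r; only
  the choice of the member that contains x does.\<close>

lemma measurable_completion_cong_AE:
  assumes g: "g \<in> measurable M N" and ae: "AE x in M. f x = g x" and f: "f \<in> space M \<rightarrow> space N"
  shows "f \<in> measurable (completion M) N"
proof (rule measurableI)
  show "\<And>x. x \<in> space (completion M) \<Longrightarrow> f x \<in> space N"
    using f by auto
  fix A assume A: "A \<in> sets N"
  show "f -` A \<inter> space (completion M) \<in> sets (completion M)"
  proof (rule complete_measure.in_sets_AE[OF completion.complete_measure_axioms])
    show "g -` A \<inter> space M \<in> sets (completion M)"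
      using measurable_sets[OF g A] by (rule sets_completionI_sets)
    have "AE x in completion M. f x = g x"
      using ae by (rule AE_completion)
    then show "AE x in completion M. x \<in> g -` A \<inter> space M \<longleftrightarrow> x \<in> f -` A \<inter> space (completion M)"
      by eventually_elim auto
  qed auto
qed

lemma completion_ex_borel_measurable_complex:
  fixes f :: "'a \<Rightarrow> complex"
  assumes f: "f \<in> borel_measurable (completion M)"
  obtains g where "g \<in> borel_measurable M" "AE x in M. f x = g x"
proof -
  have m: "(\<lambda>x. Re (f x)) \<in> borel_measurable (completion M)" "(\<lambda>x. Im (f x)) \<in> borel_measurable (completion M)"
    using f by simp_all
  obtain u where u [measurable]: "u \<in> borel_measurable M" and ae_u: "AE x in M. Re (f x) = u x"
    using completion_ex_borel_measurable_real[OF m(1)] by blast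
  obtain v where v [measurable]: "v \<in> borel_measurable M" and ae_v: "AE x in M. Im (f x) = v x"
    using completion_ex_borel_measurable_real[OF m(2)] by blast
  have "AE x in M. f x = Complex (u x) (v x)"
    using ae_u ae_v by eventually_elim (simp add: complex_eq_iff)
  moreover have "(\<lambda>x. Complex (u x) (v x)) \<in> borel_measurable M"
    unfolding borel_measurable_complex_iff by simp
  ultimately show ?thesis
    using that by blast
qed

lemma AE_lborelE:
  assumes "AE x in lborel. P x"
  obtains N where "N \<in> null_sets lborel" "\<And>x. x \<notin> N \<Longrightarrow> P x"
proof -
  obtain N where "\<And>x. x \<in> space lborel - N \<Longrightarrow> P x" "N \<in> null_sets lborel"
    using AE_E3[OF assms] by blast
  then show ?thesis
    by (intro that[of N]) auto
qed

lemma borel_measurable_bump: "bump \<phi> \<Longrightarrow> \<phi> \<in> borel_measurable borel"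
  and isCont_bump: "bump \<phi> \<Longrightarrow> isCont \<phi> t"
  and bump_nonneg: "bump \<phi> \<Longrightarrow> 0 \<le> \<phi> t"
  and bump_le_1: "bump \<phi> \<Longrightarrow> \<phi> t \<le> 1"
proof -
  assume b: "bump \<phi>"
  then have "(deriv ^^ 0) \<phi> differentiable_on UNIV"
    unfolding bump_def by blast
  then have c: "continuous_on UNIV \<phi>"
    by (simp add: differentiable_imp_continuous_on)
  then show "\<phi> \<in> borel_measurable borel"
    by (rule borel_measurable_continuous_onI)
  show "isCont \<phi> t"
    using c by (simp add: continuous_on_eq_continuous_at)
  show "0 \<le> \<phi> t" "\<phi> t \<le> 1"
    using b by (auto simp: bump_def)
qed

lemma bump_eq_0:
  assumes "bump \<phi>" "t \<le> 1/2 \<or> 5/2 \<le> t"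
  shows "\<phi> t = 0"
proof (rule ccontr)
  assume "\<phi> t \<noteq> 0"
  then have "t \<in> closure (support_on UNIV \<phi>)"
    by (intro subsetD[OF closure_subset]) (simp add: support_on_def)
  with assms show False
    by (auto simp: bump_def)
qed

subsection \<open>Restriction to the reflected parabola\<close>

definition par_point :: "real \<times> real \<Rightarrow> real \<Rightarrow> real \<times> real" where
  "par_point x t = (fst x - t, snd x - t\<^sup>2)"

lemma par_point_add: "par_point x t + (t, t\<^sup>2) = x"
  by (simp add: par_point_def prod_eq_iff)

lemma measurable_par_point [measurable (raw)]:
  assumes "f \<in> borel_measurable M" "g \<in> borel_measurable M"
  shows "(\<lambda>y. par_point (f y) (g y)) \<in> borel_measurable M"
proof -
  have "(\<lambda>y. par_point (fst y) (snd y)) \<in> borel_measurable borel"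
    unfolding par_point_def by (intro borel_measurable_continuous_onI continuous_intros)
  then show ?thesis
    using measurable_compose[OF borel_measurable_Pair[OF assms], of "\<lambda>y. par_point (fst y) (snd y)" borel] by simp
qed

text \<open>For fixed \<open>t\<close> the map from \<open>x\<close> to \<open>par_point x t\<close>
  is a translation, so after Tonelli the inner integral over the plane does not depend on
  \<open>t\<close>. The weight \<open>w\<close> serves to cut off the parameter. Every passage from
  planar measure to slices rests on this identity.\<close>

lemma nn_integral_par_point:
  fixes h :: "real \<times> real \<Rightarrow> ennreal" and w :: "real \<Rightarrow> ennreal"
  assumes [measurable]: "h \<in> borel_measurable borel" "w \<in> borel_measurable borel"
  shows "(\<integral>\<^sup>+x. \<integral>\<^sup>+t. h (par_point x t) * w t \<partial>lborel \<partial>lborel)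
    = integral\<^sup>N lborel h * integral\<^sup>N lborel w"
proof -
  have shift: "(\<integral>\<^sup>+x. h (par_point x t) \<partial>lborel) = integral\<^sup>N lborel h" for t
  proof -
    have "integral\<^sup>N lborel h = integral\<^sup>N (distr lborel borel ((+) (- t, - t\<^sup>2))) h"
      by (simp only: lborel_distr_plus)
    also have "\<dots> = (\<integral>\<^sup>+x. h ((- t, - t\<^sup>2) + x) \<partial>lborel)"
      by (rule nn_integral_distr) auto
    also have "\<dots> = (\<integral>\<^sup>+x. h (par_point x t) \<partial>lborel)"
      by (intro nn_integral_cong arg_cong[where f = h]) (simp add: par_point_def prod_eq_iff)
    finally show ?thesis by simp
  qed
  have "(\<integral>\<^sup>+x. \<integral>\<^sup>+t. h (par_point x t) * w t \<partial>lborel \<partial>lborel)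
      = (\<integral>\<^sup>+t. \<integral>\<^sup>+x. h (par_point x t) * w t \<partial>lborel \<partial>lborel)"
    by (rule lborel_pair.Fubini'[symmetric]) measurable
  also have "\<dots> = (\<integral>\<^sup>+t. integral\<^sup>N lborel h * w t \<partial>lborel)"
    using shift by (simp add: nn_integral_multc)
  finally show ?thesis
    by (simp add: nn_integral_cmult)
qed

lemma AE_par_point:
  assumes "AE x in lborel. P x"
  shows "AE x in lborel. AE t in lborel. P (par_point x t)"
proof -
  obtain N where N: "N \<in> null_sets lborel" "\<And>x. x \<notin> N \<Longrightarrow> P x"
    using AE_lborelE[OF assms] by blast
  have [measurable]: "N \<in> sets borel"
    using N(1) by auto
  have "(\<integral>\<^sup>+x. \<integral>\<^sup>+t. indicator N (par_point x t) * 1 \<partial>lborel \<partial>lborel)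
      = emeasure lborel N * integral\<^sup>N lborel (\<lambda>t::real. 1)"
    by (subst nn_integral_par_point) simp_all
  \<comment> \<open>The second factor is infinite, but zero times infinity is zero in
    \<open>ennreal\<close>.\<close>
  also have "\<dots> = 0"
    using N(1) by (simp add: null_sets_def)
  finally have "AE x in lborel. (\<integral>\<^sup>+t. indicator N (par_point x t) \<partial>lborel) = (0::ennreal)"
    by (subst (asm) nn_integral_0_iff_AE) simp_all
  then show ?thesis
  proof eventually_elim
    case (elim x)
    then have "AE t in lborel. indicator N (par_point x t) = (0::ennreal)"
      by (subst (asm) nn_integral_0_iff_AE) simp_all
    then show ?case
      by eventually_elim (use N(2) in \<open>auto simp: indicator_eq_0_iff\<close>)
  qed
qed

subsection \<open>Averages of a single atom\<close>

lemma A_par_borel: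
  assumes "bump \<phi>" and [measurable]: "g \<in> borel_measurable borel"
  shows "A_par \<phi> r g x = (LINT t|lborel. g (par_point x t) * complex_of_real (\<phi> (t / r) / r))"
proof -
  note [measurable] = borel_measurable_bump[OF assms(1)]
  have "A_par \<phi> r g x = (LINT t|lebesgue. g (par_point x t) * complex_of_real (\<phi> (t / r) / r))"
    by (simp add: A_par_def par_point_def)
  also have "\<dots> = (LINT t|lborel. g (par_point x t) * complex_of_real (\<phi> (t / r) / r))"
    by (rule integral_completion) measurable
  finally show ?thesis .
qed

lemma bump_scaled_bounds:
  assumes "bump \<phi>" "0 < r"
  shows "0 \<le> \<phi> (t / r) / r" "\<phi> (t / r) / r \<le> indicator {r/2<..<5*r/2} t / r"
proof -
  show "0 \<le> \<phi> (t / r) / r"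
    using assms by (simp add: bump_nonneg)
  show "\<phi> (t / r) / r \<le> indicator {r/2<..<5*r/2} t / r"
  proof (cases "t \<in> {r/2<..<5*r/2}")
    case False
    then have "\<phi> (t / r) = 0"
      using assms by (intro bump_eq_0) (auto simp: field_simps)
    with False show ?thesis by simp
  qed (use assms bump_le_1 in \<open>auto simp: field_simps\<close>)
qed

lemma cmod_A_par_le:
  assumes \<phi>: "bump \<phi>" and [measurable]: "g \<in> borel_measurable borel" and r: "0 < r"
  shows "ennreal (cmod (A_par \<phi> r g x))
    \<le> (\<integral>\<^sup>+t. ennreal (cmod (g (par_point x t))) * ennreal (indicator {r/2<..<5*r/2} t / r) \<partial>lborel)"
proof (cases "integrable lborel (\<lambda>t. g (par_point x t) * complex_of_real (\<phi> (t / r) / r))")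
  case True
  have "ennreal (cmod (A_par \<phi> r g x))
      \<le> (\<integral>\<^sup>+t. ennreal (cmod (g (par_point x t) * complex_of_real (\<phi> (t / r) / r))) \<partial>lborel)"
    unfolding A_par_borel[OF \<phi> assms(2)] by (rule integral_norm_bound_ennreal[OF True])
  also have "\<dots> \<le> (\<integral>\<^sup>+t. ennreal (cmod (g (par_point x t))) * ennreal (indicator {r/2<..<5*r/2} t / r) \<partial>lborel)"
  proof (rule nn_integral_mono)
    fix t
    have "cmod (g (par_point x t) * complex_of_real (\<phi> (t / r) / r))
        \<le> cmod (g (par_point x t)) * (indicator {r/2<..<5*r/2} t / r)"
      unfolding norm_mult norm_of_real
      using bump_scaled_bounds[OF \<phi> r, of t] by (intro mult_left_mono) auto
    then show "ennreal (cmod (g (par_point x t) * complex_of_real (\<phi> (t / r) / r)))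
        \<le> ennreal (cmod (g (par_point x t))) * ennreal (indicator {r/2<..<5*r/2} t / r)"
      by (simp add: ennreal_mult'[symmetric] ennreal_leI)
  qed
  finally show ?thesis .
next
  \<comment> \<open>A slice that is not integrable has the default Bochner integral 0, for which the
    bound is trivial.\<close>
  case False
  then show ?thesis
    unfolding A_par_borel[OF \<phi> assms(2)] by (subst not_integrable_integral_eq) auto
qed

lemma mem_pbox: "y \<in> pbox z \<rho> \<longleftrightarrow> \<bar>fst y - fst z\<bar> \<le> \<rho> \<and> \<bar>snd y - snd z\<bar> \<le> \<rho>\<^sup>2"
proof -
  have "y \<in> (+) z ` A \<longleftrightarrow> y - z \<in> A" for A
    by (auto intro!: image_eqI[of _ _ "y - z"])
  then have "y \<in> pbox z \<rho> \<longleftrightarrow> y - z \<in> {-\<rho>..\<rho>} \<times> {-(\<rho>\<^sup>2)..\<rho>\<^sup>2}"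
    unfolding pbox_def .
  then show ?thesis
    by (auto simp: mem_Times_iff abs_le_iff)
qed

lemma pbox_eq_cbox:
  "pbox z \<rho> = cbox (fst z - \<rho>, snd z - \<rho>\<^sup>2) (fst z + \<rho>, snd z + \<rho>\<^sup>2)"
  by (auto simp: mem_pbox cbox_Pair_eq abs_le_iff)

lemma measurable_pbox [measurable]: "pbox z \<rho> \<in> sets borel"
  by (simp add: pbox_eq_cbox)

lemma measure_pbox:
  assumes "0 \<le> \<rho>"
  shows "measure lebesgue (pbox z \<rho>) = 4 * \<rho> ^ 3"
proof -
  have "measure lebesgue (pbox z \<rho>) = (2 * \<rho>) * (2 * \<rho>\<^sup>2)"
    unfolding pbox_eq_cbox using assms by (subst measure_completion) (simp_all add: content_Pair)
  then show ?thesis by (simp add: power3_eq_cube power2_eq_square)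
qed

text \<open>The curve has speed at least \<open>r\<close> in the vertical direction for \<open>t > r/2\<close>, so it spends time at
  most of order \<open>\<rho>\<^sup>2 / r\<close> in a box of height \<open>2 * \<rho>\<^sup>2\<close>.\<close>
lemma emeasure_par_point_pbox:
  fixes r \<rho> :: real and x z :: "real \<times> real"
  assumes r: "0 < r"
  defines "S \<equiv> {t. t \<in> {r/2<..<5*r/2} \<and> par_point x t \<in> pbox z \<rho>}"
  shows "emeasure lborel S \<le> ennreal (4 * r * min 1 ((\<rho> / r)\<^sup>2))"
proof -
  have "emeasure lborel S \<le> emeasure lborel {r/2<..<5*r/2}"
    by (rule emeasure_mono) (auto simp: S_def)
  \<comment> \<open>The window has length 2r; the larger 4r lets both bounds share one
    constant.\<close>
  also have "\<dots> \<le> ennreal (4 * r)"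
    using r by (simp add: ennreal_leI)
  finally have 1: "emeasure lborel S \<le> ennreal (4 * r)" .
  have 2: "emeasure lborel S \<le> ennreal (4 * r * (\<rho> / r)\<^sup>2)"
  proof (cases "S = {}")
    case False
    then obtain u where u: "u \<in> S" by blast
    \<comment> \<open>Here d = 2 rho^2 / r: two parameters in \<open>S\<close> have sum above r, and
      their squares differ by at most 2 rho^2. The interval around \<open>u\<close> has length
      2d.\<close>
    define d where "d = 2 * r * (\<rho> / r)\<^sup>2"
    have "S \<subseteq> {u - d..u + d}"
    proof
      fix t assume t: "t \<in> S"
      have "\<bar>t\<^sup>2 - u\<^sup>2\<bar> \<le> 2 * \<rho>\<^sup>2"
        using t u by (auto simp: S_def mem_pbox par_point_def)
      then have "\<bar>t - u\<bar> * (t + u) \<le> 2 * \<rho>\<^sup>2"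
        using t u r by (simp add: S_def power2_eq_square square_diff_square_factored abs_mult mult.commute)
      moreover have "\<bar>t - u\<bar> * r \<le> \<bar>t - u\<bar> * (t + u)"
        using t u by (intro mult_left_mono) (auto simp: S_def)
      ultimately have "\<bar>t - u\<bar> \<le> d"
        using r by (simp add: d_def field_simps power2_eq_square)
      then show "t \<in> {u - d..u + d}" by auto
    qed
    then have "emeasure lborel S \<le> emeasure lborel {u - d..u + d}"
      by (rule emeasure_mono) auto
    also have "\<dots> = ennreal (4 * r * (\<rho> / r)\<^sup>2)"
      using r by (simp add: d_def)
    finally show ?thesis .
  qed simp
  show ?thesis
    using 1 2 by (auto simp: min_def)
qed

text \<open>The integrand is at most M / r and vanishes off the set of times spent in the box, whose
  measure carries a factor r; the two factors cancel.\<close>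

lemma cmod_A_par_pbox_le:
  assumes \<phi>: "bump \<phi>" and g [measurable]: "g \<in> borel_measurable borel" and r: "0 < r"
    and M: "0 \<le> M" "\<And>y. cmod (g y) \<le> M" and supp: "\<And>y. y \<notin> pbox z \<rho> \<Longrightarrow> g y = 0"
  shows "cmod (A_par \<phi> r g x) \<le> 4 * M * min 1 ((\<rho> / r)\<^sup>2)"
proof -
  define S where "S = {t. t \<in> {r/2<..<5*r/2} \<and> par_point x t \<in> pbox z \<rho>}"
  have [measurable]: "S \<in> sets borel"
    unfolding S_def by measurable
  have "ennreal (cmod (A_par \<phi> r g x))
      \<le> (\<integral>\<^sup>+t. ennreal (cmod (g (par_point x t))) * ennreal (indicator {r/2<..<5*r/2} t / r) \<partial>lborel)"
    by (rule cmod_A_par_le[OF \<phi> g r])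
  also have "\<dots> \<le> (\<integral>\<^sup>+t. ennreal (M / r) * indicator S t \<partial>lborel)"
  proof (rule nn_integral_mono)
    fix t
    show "ennreal (cmod (g (par_point x t))) * ennreal (indicator {r/2<..<5*r/2} t / r)
      \<le> ennreal (M / r) * indicator S t"
    proof (cases "t \<in> S")
      case True
      then have "ennreal (cmod (g (par_point x t))) * ennreal (indicator {r/2<..<5*r/2} t / r)
          = ennreal (cmod (g (par_point x t)) / r)"
        using r by (simp add: S_def ennreal_mult'[symmetric])
      also have "\<dots> \<le> ennreal (M / r)"
        using r M by (intro ennreal_leI divide_right_mono) auto
      finally show ?thesis using True by simp
    next
      case False
      then have "t \<notin> {r/2<..<5*r/2} \<or> g (par_point x t) = 0"
        using supp by (auto simp: S_def)
      then show ?thesis by auto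
    qed
  qed
  also have "\<dots> = ennreal (M / r) * emeasure lborel S"
    by (simp add: nn_integral_cmult)
  also have "\<dots> \<le> ennreal (M / r) * ennreal (4 * r * min 1 ((\<rho> / r)\<^sup>2))"
    unfolding S_def by (intro mult_left_mono emeasure_par_point_pbox r) simp
  also have "\<dots> = ennreal (4 * M * min 1 ((\<rho> / r)\<^sup>2))"
    using r M by (simp add: ennreal_mult'[symmetric])
  finally show ?thesis
    using M by (simp add: ennreal_le_iff)
qed

lemma A_par_nonzero_imp_mem_tendril:
  assumes \<phi>: "bump \<phi>" and g: "g \<in> borel_measurable borel" and r: "0 < r"
    and supp: "\<And>y. y \<notin> pbox z \<rho> \<Longrightarrow> g y = 0" and nz: "A_par \<phi> r g x \<noteq> 0" and R: "5 * r / 2 \<le> R" and \<rho>: "0 < \<rho>"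
  shows "x \<in> tendril z \<rho> R"
proof -
  have "\<exists>t. g (par_point x t) * complex_of_real (\<phi> (t / r) / r) \<noteq> 0"
  proof (rule ccontr)
    assume "\<nexists>t. g (par_point x t) * complex_of_real (\<phi> (t / r) / r) \<noteq> 0"
    then have "g (par_point x t) * complex_of_real (\<phi> (t / r) / r) = 0" for t
      by blast
    then have "A_par \<phi> r g x = 0"
      unfolding A_par_borel[OF \<phi> g] by (simp only: integral_zero)
    with nz show False by simp
  qed
  then obtain t where t: "g (par_point x t) \<noteq> 0" "\<phi> (t / r) \<noteq> 0"
    by auto
  then have "1/2 < t / r" "t / r < 5/2"
    using bump_eq_0[OF \<phi>, of "t / r"] by (auto simp: not_le[symmetric])
  then have "\<bar>t\<bar> \<le> R"
    using r R by (auto simp: field_simps)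
  moreover have "par_point x t \<in> pbox z (4 * \<rho>)"
  proof -
    have "par_point x t \<in> pbox z \<rho>"
      using supp t(1) by blast
    moreover have "\<rho> \<le> 4 * \<rho>" "\<rho>\<^sup>2 \<le> (4 * \<rho>)\<^sup>2"
      using \<rho> by (auto intro!: power_mono)
    ultimately show ?thesis
      unfolding mem_pbox by linarith
  qed
  ultimately have "par_point x t + (t, t\<^sup>2) \<in> tendril z \<rho> R"
    unfolding tendril_def by (intro set_plus_intro) auto
  then show ?thesis
    by (simp add: par_point_add)
qed

subsection \<open>Fractional tendril covers for one atom\<close>

text \<open>The tendril used is the shortest of the dyadic family that reaches 5r/2. If it is not
  the first one, minimality bounds rho/r from above, and the quadratic decay turns this into the
  weight 4^(-k).\<close>

lemma ex_tendril_scale: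
  fixes \<beta> r \<rho> v :: real
  assumes \<rho>: "0 < \<rho>" and r: "0 < r" and \<beta>: "0 \<le> \<beta>" and v: "0 \<le> v" "v \<le> \<beta> * min 1 ((\<rho> / r)\<^sup>2)"
    and mem: "\<And>R. v \<noteq> 0 \<Longrightarrow> 5 * r / 2 \<le> R \<Longrightarrow> x \<in> tendril z \<rho> R"
  shows "\<exists>k. min 1 v \<le> 25 * min 1 \<beta> / 4 ^ k * indicator (tendril z \<rho> (2 ^ k * max 1 (sqrt \<beta>) * \<rho>)) x"
proof (cases "v = 0")
  case True
  then show ?thesis
    using \<beta> by (intro exI[of _ 0]) simp
next
  case False
  \<comment> \<open>At r = sqrt(beta) * rho the bound beta (rho/r)^2 equals 1; the maximum with 1
    keeps the length at least rho, as a tendril in a cover requires.\<close>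
  define s where "s = max 1 (sqrt \<beta>)"
  have s: "1 \<le> s" and s2: "s\<^sup>2 = max 1 \<beta>"
    using \<beta> by (auto simp: s_def max_def)
  define P where "P k \<longleftrightarrow> 5 * r / 2 \<le> 2 ^ k * s * \<rho>" for k :: nat
  have "\<exists>k. P k"
  proof -
    obtain k where "5 * r / 2 / (s * \<rho>) < 2 ^ k"
      using real_arch_pow[of 2 "5 * r / 2 / (s * \<rho>)"] by auto
    then have "P k"
      using s \<rho> by (simp add: P_def field_simps)
    then show ?thesis ..
  qed
  define k where "k = (LEAST k. P k)"
  have Pk: "P k"
    unfolding k_def using \<open>\<exists>k. P k\<close> by (rule LeastI_ex)
  have "min 1 v \<le> 25 * min 1 \<beta> / 4 ^ k"
  proof (cases k)
    case 0
    have "\<beta> * min 1 ((\<rho> / r)\<^sup>2) \<le> \<beta> * 1"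
      using \<beta> by (intro mult_left_mono) auto
    then show ?thesis
      using 0 v \<beta> by auto
  next
    case (Suc j)
    then have "\<not> P j"
      using not_less_Least[of j P] by (simp add: k_def)
    \<comment> \<open>As k = j + 1, the right side is 5 / (2^k s), the source of the constant 25.
      Since s^2 = max 1 beta, dividing beta by s^2 leaves min 1 beta.\<close>
    then have "\<rho> / r \<le> 5 / (2 * 2 ^ j * s)"
      using r s by (simp add: P_def field_simps)
    then have "(\<rho> / r)\<^sup>2 \<le> (5 / (2 * 2 ^ j * s))\<^sup>2"
      using r \<rho> by (intro power_mono) auto
    also have "\<dots> = 25 / (4 ^ k * s\<^sup>2)"
      by (simp add: Suc power_divide power_mult_distrib power2_eq_square flip: power_mult_distrib)
    finally have "(\<rho> / r)\<^sup>2 \<le> 25 / (4 ^ k * s\<^sup>2)" .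
    then have "\<beta> * min 1 ((\<rho> / r)\<^sup>2) \<le> \<beta> * (25 / (4 ^ k * s\<^sup>2))"
      using \<beta> by (intro mult_left_mono) auto
    also have "\<dots> = 25 * min 1 \<beta> / 4 ^ k"
      using \<beta> by (auto simp: s2 max_def min_def field_simps)
    finally show ?thesis
      using v by simp
  qed
  moreover have "x \<in> tendril z \<rho> (2 ^ k * s * \<rho>)"
    using mem[OF False] Pk by (simp add: P_def)
  ultimately show ?thesis
    by (intro exI[of _ k]) (simp add: s_def)
qed

text \<open>A tendril 2^k times longer costs 4^(pk) times more and has weight 4^(-k), so the series
  is geometric with ratio \<open>q\<close> = 4^(p-1), which is below 1 because p < 1.\<close>

lemma suminf_tendril_cost:
  fixes \<beta> \<rho> p :: real
  assumes p: "0 < p" "p < 1" and \<rho>: "0 < \<rho>" and \<beta>: "0 \<le> \<beta>"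
  shows "(\<Sum>k. ennreal (25 * min 1 \<beta> / 4 ^ k * \<rho> * (2 ^ k * max 1 (sqrt \<beta>) * \<rho>) powr (2 * p)))
    \<le> ennreal (25 / (1 - 4 powr (p - 1)) * (\<beta> powr p * \<rho> powr (1 + 2 * p)))"
proof -
  define q :: real where "q = 4 powr (p - 1)"
  have q: "0 \<le> q" "q < 1"
    using p by (auto simp: q_def powr_less_one)
  have "25 * min 1 \<beta> / 4 ^ k * \<rho> * (2 ^ k * max 1 (sqrt \<beta>) * \<rho>) powr (2 * p)
      \<le> 25 * (\<beta> powr p * \<rho> powr (1 + 2 * p)) * q ^ k" for k
  proof -
    have "sqrt \<beta> powr (2 * p) = (\<beta> powr (1 / 2)) powr (2 * p)"
      using \<beta> by (simp add: powr_half_sqrt)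
    also have "\<dots> = \<beta> powr p"
      unfolding powr_powr by simp
    finally have sqrt: "sqrt \<beta> powr (2 * p) = \<beta> powr p" .
    \<comment> \<open>For beta at least 1 the two sides agree; for smaller beta the left side is
      beta, which is at most beta^p because p < 1.\<close>
    have \<beta>': "min 1 \<beta> * max 1 (sqrt \<beta>) powr (2 * p) \<le> \<beta> powr p"
    proof (cases "1 \<le> \<beta>")
      case True
      then show ?thesis
        using sqrt by (simp add: max_absorb2)
    next
      case False
      then show ?thesis
        using \<beta> p powr_mono'[of p 1 \<beta>] by (simp add: max_absorb1)
    qed
    have "2 powr (2 * p) = (2 powr 2 :: real) powr p"
      unfolding powr_powr ..
    also have "\<dots> = q * 4"
      by (simp add: q_def powr_diff)
    finally have "(2 powr (2 * p)) ^ k = q ^ k * 4 ^ k"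
      by (simp add: power_mult_distrib)
    moreover have "(2 powr (2 * p)) ^ k = (2 ^ k :: real) powr (2 * p)"
      by (simp add: powr_power powr_powr mult_ac flip: powr_realpow)
    ultimately have q': "(2 ^ k :: real) powr (2 * p) = q ^ k * 4 ^ k"
      by simp
    have "25 * min 1 \<beta> / 4 ^ k * \<rho> * (2 ^ k * max 1 (sqrt \<beta>) * \<rho>) powr (2 * p)
        = 25 * (min 1 \<beta> * max 1 (sqrt \<beta>) powr (2 * p)) * \<rho> powr (1 + 2 * p) * q ^ k"
      using \<rho> by (simp add: powr_mult powr_add q')
    also have "\<dots> \<le> 25 * (\<beta> powr p) * \<rho> powr (1 + 2 * p) * q ^ k"
      using q \<beta>' by (intro mult_right_mono mult_left_mono) auto
    finally show ?thesis by (simp add: mult_ac)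
  qed
  then have "(\<Sum>k. ennreal (25 * min 1 \<beta> / 4 ^ k * \<rho> * (2 ^ k * max 1 (sqrt \<beta>) * \<rho>) powr (2 * p)))
      \<le> (\<Sum>k. ennreal (25 * (\<beta> powr p * \<rho> powr (1 + 2 * p)) * q ^ k))"
    by (intro suminf_le ennreal_leI) auto
  also have "\<dots> = ennreal (\<Sum>k. 25 * (\<beta> powr p * \<rho> powr (1 + 2 * p)) * q ^ k)"
    using q by (intro suminf_ennreal2 summable_mult summable_geometric) auto
  also have "(\<Sum>k. 25 * (\<beta> powr p * \<rho> powr (1 + 2 * p)) * q ^ k)
      = 25 * (\<beta> powr p * \<rho> powr (1 + 2 * p)) * (1 / (1 - q))"
    using q by (subst suminf_mult) (auto simp: suminf_geometric summable_geometric)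
  finally show ?thesis
    by (simp add: q_def mult_ac)
qed

subsection \<open>Local integrability along the parabola\<close>

abbreviation sq_box :: "nat \<Rightarrow> (real \<times> real) set" where
  "sq_box n \<equiv> cbox (- real n, - real n) (real n, real n)"

text \<open>All bounded arcs are required at once, so that a single null set of \<open>x\<close>
  serves every radius. Values in \<open>ennreal\<close> allow infinite sums of functions.\<close>

definition par_loc_integrable :: "(real \<times> real \<Rightarrow> ennreal) \<Rightarrow> real \<times> real \<Rightarrow> bool" where
  "par_loc_integrable h x \<longleftrightarrow> (\<forall>T. (\<integral>\<^sup>+t. h (par_point x t) * indicator {-T..T} t \<partial>lborel) < \<infinity>)"

text \<open>The two coordinates are bounded by 2n and n + n^2; their common bound 2n + n^2 fixes the
  larger box.\<close>

lemma par_point_mem_sq_box: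
  assumes "x \<in> sq_box n" "t \<in> {-T..T}" "T \<le> real n"
  shows "par_point x t \<in> sq_box (2 * n + n\<^sup>2)"
proof -
  have "t\<^sup>2 \<le> (real n)\<^sup>2"
    using assms(2,3) by (intro abs_le_square_iff[THEN iffD1]) auto
  moreover have "0 \<le> t\<^sup>2" by simp
  moreover have "\<bar>fst x\<bar> \<le> real n" "\<bar>snd x\<bar> \<le> real n" "\<bar>t\<bar> \<le> real n"
    using assms by (auto simp: cbox_Pair_eq mem_Times_iff abs_le_iff)
  ultimately have "\<bar>fst x - t\<bar> \<le> 2 * real n + (real n)\<^sup>2" "\<bar>snd x - t\<^sup>2\<bar> \<le> 2 * real n + (real n)\<^sup>2"
    unfolding abs_le_iff by linarith+
  then show ?thesis
    unfolding par_point_def cbox_Pair_eq mem_Times_iff by (auto simp: abs_le_iff)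
qed

lemma ex_sq_box:
  fixes x :: "real \<times> real" and T :: real
  obtains n where "x \<in> sq_box n" "T \<le> real n"
proof -
  obtain n where n: "max (max \<bar>fst x\<bar> \<bar>snd x\<bar>) T \<le> real n"
    using real_arch_simple by blast
  then have "\<bar>fst x\<bar> \<le> real n" "\<bar>snd x\<bar> \<le> real n" "T \<le> real n"
    by auto
  then show ?thesis
    by (intro that[of n]) (auto simp: mem_Times_iff cbox_Pair_eq abs_le_iff)
qed

lemma AE_par_loc_integrable:
  fixes h :: "real \<times> real \<Rightarrow> ennreal"
  assumes [measurable]: "h \<in> borel_measurable borel"
    and fin: "\<And>n. (\<integral>\<^sup>+x. h x * indicator (sq_box n) x \<partial>lborel) < \<infinity>"
  shows "AE x in lborel. par_loc_integrable h x"
proof -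
  \<comment> \<open>Cutting to the larger box makes the planar integral finite and changes nothing
    on arcs with |t| \<le> n for \<open>x\<close> in \<open>sq_box n\<close>. Countably many n then
    reach every \<open>x\<close> and \<open>T\<close>.\<close>
  define H where "H n x = h x * indicator (sq_box (2 * n + n\<^sup>2)) x" for n x
  have [measurable]: "H n \<in> borel_measurable borel" for n
    unfolding H_def by measurable
  have "AE x in lborel. (\<integral>\<^sup>+t. H n (par_point x t) * indicator {-real n..real n} t \<partial>lborel) \<noteq> \<infinity>" for n
  proof (rule nn_integral_PInf_AE)
    have "(\<integral>\<^sup>+x. \<integral>\<^sup>+t. H n (par_point x t) * indicator {-real n..real n} t \<partial>lborel \<partial>lborel)
        = integral\<^sup>N lborel (H n) * integral\<^sup>N lborel (indicator {-real n..real n})"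
      by (rule nn_integral_par_point) auto
    also have "\<dots> < \<infinity>"
      using fin[of "2 * n + n\<^sup>2"] by (simp add: H_def[abs_def] ennreal_mult_less_top)
    finally show "(\<integral>\<^sup>+x. \<integral>\<^sup>+t. H n (par_point x t) * indicator {-real n..real n} t \<partial>lborel \<partial>lborel) \<noteq> \<infinity>"
      by simp
  qed measurable
  then have "AE x in lborel. \<forall>n. (\<integral>\<^sup>+t. H n (par_point x t) * indicator {-real n..real n} t \<partial>lborel) \<noteq> \<infinity>"
    by (simp add: AE_all_countable)
  then show ?thesis
  proof eventually_elim
    case (elim x)
    show ?case
      unfolding par_loc_integrable_def
    proof
      fix T :: real
      obtain n where n: "x \<in> sq_box n" "T \<le> real n"
        by (rule ex_sq_box)
      have "h (par_point x t) * indicator {-T..T} t \<le> H n (par_point x t) * indicator {-real n..real n} t" for t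
        using n par_point_mem_sq_box[OF n(1) _ n(2), of t] by (auto simp: H_def split: split_indicator)
      then have "(\<integral>\<^sup>+t. h (par_point x t) * indicator {-T..T} t \<partial>lborel)
          \<le> (\<integral>\<^sup>+t. H n (par_point x t) * indicator {-real n..real n} t \<partial>lborel)"
        by (intro nn_integral_mono) auto
      also have "\<dots> < \<infinity>"
        using elim by (simp add: less_top)
      finally show "(\<integral>\<^sup>+t. h (par_point x t) * indicator {-T..T} t \<partial>lborel) < \<infinity>" .
    qed
  qed
qed

lemma tendsto_0_of_suminf_ennreal_finite:
  fixes a :: "nat \<Rightarrow> ennreal"
  assumes "(\<Sum>k. a k) < \<infinity>"
  shows "a \<longlonglongrightarrow> 0"
proof -
  have fin: "a k < \<infinity>" for k
    using ennreal_suminf_lessD[OF assms] .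
  then have eq: "a k = ennreal (enn2real (a k))" for k
    by (simp add: less_top)
  have "summable (\<lambda>k. enn2real (a k))"
  proof (rule summable_suminf_not_top)
    show "(\<Sum>k. ennreal (enn2real (a k))) \<noteq> top"
      using assms eq by simp
  qed simp
  then have "(\<lambda>k. ennreal (enn2real (a k))) \<longlonglongrightarrow> ennreal 0"
    by (intro tendsto_ennrealI summable_LIMSEQ_zero)
  then show ?thesis
    using eq by simp
qed

text \<open>The functions cut to \<open>sq_box k\<close> have a sum that is integrable over the
  plane, hence integrable on bounded arcs of almost every parabola, and the terms of a convergent
  series tend to 0. For large k the cut removes nothing from a fixed arc.\<close>

lemma AE_par_point_tendsto_0:
  fixes d :: "nat \<Rightarrow> real \<times> real \<Rightarrow> ennreal"
  assumes [measurable]: "\<And>k. d k \<in> borel_measurable borel"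
    and fin: "(\<Sum>k. \<integral>\<^sup>+x. d k x * indicator (sq_box k) x \<partial>lborel) < \<infinity>"
  shows "AE x in lborel. \<forall>T. (\<lambda>k. \<integral>\<^sup>+t. d k (par_point x t) * indicator {-T..T} t \<partial>lborel) \<longlonglongrightarrow> 0"
proof -
  define h where "h x = (\<Sum>k. d k x * indicator (sq_box k) x)" for x
  have [measurable]: "h \<in> borel_measurable borel"
    unfolding h_def by measurable
  have "AE x in lborel. par_loc_integrable h x"
  proof (rule AE_par_loc_integrable)
    fix n
    have "(\<integral>\<^sup>+x. h x * indicator (sq_box n) x \<partial>lborel) \<le> (\<integral>\<^sup>+x. h x \<partial>lborel)"
      by (intro nn_integral_mono) (auto split: split_indicator)
    also have "\<dots> < \<infinity>"
      using fin unfolding h_def by (subst nn_integral_suminf) auto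
    finally show "(\<integral>\<^sup>+x. h x * indicator (sq_box n) x \<partial>lborel) < \<infinity>" .
  qed measurable
  then show ?thesis
  proof eventually_elim
    case (elim x)
    show ?case
    proof
      fix T :: real
      define a where "a k = (\<integral>\<^sup>+t. d k (par_point x t) * indicator (sq_box k) (par_point x t)
        * indicator {-T..T} t \<partial>lborel)" for k
      have "(\<Sum>k. a k) = (\<integral>\<^sup>+t. h (par_point x t) * indicator {-T..T} t \<partial>lborel)"
        unfolding a_def h_def by (subst nn_integral_suminf[symmetric]) auto
      also have "\<dots> < \<infinity>"
        using elim by (simp add: par_loc_integrable_def)
      finally have a: "a \<longlonglongrightarrow> 0"
        by (rule tendsto_0_of_suminf_ennreal_finite)
      obtain n where n: "x \<in> sq_box n" "T \<le> real n"
        by (rule ex_sq_box)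
      have "a k = (\<integral>\<^sup>+t. d k (par_point x t) * indicator {-T..T} t \<partial>lborel)" if k: "2 * n + n\<^sup>2 \<le> k" for k
      proof -
        have "sq_box (2 * n + n\<^sup>2) \<subseteq> sq_box k"
          using of_nat_mono[OF k, where 'a = real] by (auto simp: subset_box cbox_Pair_eq)
        then have "par_point x t \<in> sq_box k" if "t \<in> {-T..T}" for t
          using par_point_mem_sq_box[OF n(1) that n(2)] by blast
        then show ?thesis
          unfolding a_def by (intro nn_integral_cong) (auto split: split_indicator)
      qed
      then have "eventually (\<lambda>k. a k = (\<integral>\<^sup>+t. d k (par_point x t) * indicator {-T..T} t \<partial>lborel)) sequentially"
        unfolding eventually_sequentially by blast
      with a show "(\<lambda>k. \<integral>\<^sup>+t. d k (par_point x t) * indicator {-T..T} t \<partial>lborel) \<longlonglongrightarrow> 0"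
        by (rule Lim_transform_eventually)
    qed
  qed
qed

lemma indicator_Ioo_le_Icc:
  assumes "0 < (r::real)" "5 * r / 2 \<le> T"
  shows "ennreal (indicator {r/2<..<5*r/2} t / r) \<le> ennreal (1 / r) * indicator {-T..T} t"
  using assms by (auto split: split_indicator)

lemma integrable_par_point_bump:
  assumes \<phi>: "bump \<phi>" and r: "0 < r" and [measurable]: "g \<in> borel_measurable borel"
    and g: "par_loc_integrable (\<lambda>y. ennreal (cmod (g y))) x"
  shows "integrable lborel (\<lambda>t. g (par_point x t) * complex_of_real (\<phi> (t / r) / r))"
proof (rule integrableI_bounded)
  note [measurable] = borel_measurable_bump[OF \<phi>]
  show "(\<lambda>t. g (par_point x t) * complex_of_real (\<phi> (t / r) / r)) \<in> borel_measurable lborel"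
    by measurable
  have "(\<integral>\<^sup>+t. ennreal (cmod (g (par_point x t) * complex_of_real (\<phi> (t / r) / r))) \<partial>lborel)
      \<le> (\<integral>\<^sup>+t. ennreal (1 / r) * (ennreal (cmod (g (par_point x t))) * indicator {-(5*r/2)..5*r/2} t) \<partial>lborel)"
  proof (rule nn_integral_mono)
    fix t
    have "ennreal (cmod (g (par_point x t) * complex_of_real (\<phi> (t / r) / r)))
        = ennreal (cmod (g (par_point x t))) * ennreal (\<phi> (t / r) / r)"
      unfolding norm_mult norm_of_real using bump_scaled_bounds[OF \<phi> r, of t]
      by (simp only: ennreal_mult' abs_of_nonneg norm_ge_zero)
    also have "\<dots> \<le> ennreal (cmod (g (par_point x t))) * (ennreal (1 / r) * indicator {-(5*r/2)..5*r/2} t)"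
      by (intro mult_left_mono order_trans[OF ennreal_leI[OF bump_scaled_bounds(2)[OF \<phi> r]]]
          indicator_Ioo_le_Icc[OF r]) auto
    finally show "ennreal (cmod (g (par_point x t) * complex_of_real (\<phi> (t / r) / r)))
        \<le> ennreal (1 / r) * (ennreal (cmod (g (par_point x t))) * indicator {-(5*r/2)..5*r/2} t)"
      by (simp add: mult_ac)
  qed
  also have "\<dots> < \<infinity>"
    using g by (subst nn_integral_cmult) (auto simp: par_loc_integrable_def ennreal_mult_less_top)
  finally show "(\<integral>\<^sup>+t. ennreal (cmod (g (par_point x t) * complex_of_real (\<phi> (t / r) / r))) \<partial>lborel) < \<infinity>" .
qed

lemma par_loc_integrable_bounded:
  assumes "\<And>y. cmod (g y) \<le> M"
  shows "par_loc_integrable (\<lambda>y. ennreal (cmod (g y))) x"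
  unfolding par_loc_integrable_def
proof
  fix T :: real
  have "(\<integral>\<^sup>+t. ennreal (cmod (g (par_point x t))) * indicator {-T..T} t \<partial>lborel)
      \<le> (\<integral>\<^sup>+t. ennreal M * indicator {-T..T} t \<partial>lborel)"
    using assms by (intro nn_integral_mono mult_right_mono ennreal_leI) auto
  also have "\<dots> < \<infinity>"
    by (subst nn_integral_cmult) (auto simp: ennreal_mult_less_top emeasure_lborel_Icc_eq)
  finally show "(\<integral>\<^sup>+t. ennreal (cmod (g (par_point x t))) * indicator {-T..T} t \<partial>lborel) < \<infinity>" .
qed

text \<open>Equality at almost every parameter of the slice does not mention \<open>r\<close>, hence
  one null set for all radii.\<close>

lemma AE_A_par_cong:
  assumes \<phi>: "bump \<phi>" and [measurable]: "g \<in> borel_measurable borel" and ae: "AE y in lborel. f y = g y"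
  shows "AE x in lborel. \<forall>r. A_par \<phi> r f x = A_par \<phi> r g x"
  using AE_par_point[OF ae]
proof eventually_elim
  case (elim x)
  note [measurable] = borel_measurable_bump[OF \<phi>]
  show ?case
  proof
    fix r
    let ?F = "\<lambda>h t. h (par_point x t) * complex_of_real (\<phi> (t / r) / r)"
    have m: "?F g \<in> borel_measurable lborel"
      by measurable
    have eq: "AE t in lborel. ?F f t = ?F g t"
      using elim by eventually_elim simp
    have "integral\<^sup>L lebesgue (?F f) = integral\<^sup>L lebesgue (?F g)"
    proof (rule integral_cong_AE)
      \<comment> \<open>The slice of \<open>f\<close> need not be Borel; it is Lebesgue measurable
        as a modification of a Borel slice on a null set.\<close>
      show "?F f \<in> borel_measurable lebesgue"
        by (rule measurable_completion_cong_AE[OF m eq]) auto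
    qed (use m eq in \<open>auto intro: measurable_completion AE_completion\<close>)
    then show "A_par \<phi> r f x = A_par \<phi> r g x"
      by (simp add: A_par_def par_point_def)
  qed
qed

subsection \<open>Measurability of the maximal function\<close>

lemma tendsto_A_par:
  assumes \<phi>: "bump \<phi>" and r: "0 < r" and g [measurable]: "g \<in> borel_measurable borel"
    and loc: "par_loc_integrable (\<lambda>y. ennreal (cmod (g y))) x" and X: "X \<longlonglongrightarrow> r"
  shows "(\<lambda>n. A_par \<phi> (X n) g x) \<longlonglongrightarrow> A_par \<phi> r g x"
proof -
  note [measurable] = borel_measurable_bump[OF \<phi>]
  have "eventually (\<lambda>n. r / 2 < X n \<and> X n < 2 * r) sequentially"
    using r by (intro eventually_conj order_tendstoD[OF X]) auto
  then obtain N where N: "\<And>n. N \<le> n \<Longrightarrow> r / 2 < X n \<and> X n < 2 * r"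
    by (auto simp: eventually_sequentially)
  \<comment> \<open>Once X n lies in (r/2, 2r), the window ends before 5 * (2r) / 2 = 5r and 1 / X n
    is below 2 / r.\<close>
  define w where "w t = 2 / r * (cmod (g (par_point x t)) * indicator {-(5*r)..5*r} t)" for t
  have "(\<lambda>n. A_par \<phi> (X (n + N)) g x) \<longlonglongrightarrow> A_par \<phi> r g x"
    unfolding A_par_borel[OF \<phi> g]
  proof (rule integral_dominated_convergence[where w = w])
    show "integrable lborel w"
      unfolding w_def
    proof (intro integrable_mult_right integrableI_bounded)
      show "(\<integral>\<^sup>+t. ennreal (norm (cmod (g (par_point x t)) * indicator {-(5*r)..5*r} t)) \<partial>lborel) < \<infinity>"
        using loc by (simp add: par_loc_integrable_def ennreal_mult' ennreal_indicator)
    qed measurable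
    show "AE t in lborel. (\<lambda>n. g (par_point x t) * complex_of_real (\<phi> (t / X (n + N)) / X (n + N)))
        \<longlonglongrightarrow> g (par_point x t) * complex_of_real (\<phi> (t / r) / r)"
    proof (intro AE_I2 tendsto_mult tendsto_const tendsto_of_real tendsto_divide)
      fix t
      show X': "(\<lambda>n. X (n + N)) \<longlonglongrightarrow> r"
        using X by (rule LIMSEQ_ignore_initial_segment)
      show "(\<lambda>n. \<phi> (t / X (n + N))) \<longlonglongrightarrow> \<phi> (t / r)"
        using r by (intro isCont_tendsto_compose[OF isCont_bump[OF \<phi>]] tendsto_divide tendsto_const X') auto
    qed (use r in auto)
    show "AE t in lborel. norm (g (par_point x t) * complex_of_real (\<phi> (t / X (n + N)) / X (n + N))) \<le> w t" for n
    proof (rule AE_I2)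
      fix t
      have Xn: "r / 2 < X (n + N)" "X (n + N) < 2 * r" "0 < X (n + N)"
        using N[of "n + N"] r by auto
      have "\<phi> (t / X (n + N)) / X (n + N) \<le> indicator {X (n+N)/2<..<5*X (n+N)/2} t / X (n + N)"
        using bump_scaled_bounds(2)[OF \<phi> Xn(3)] .
      also have "\<dots> \<le> indicator {-(5*r)..5*r} t / X (n + N)"
        using Xn r by (intro divide_right_mono) (auto split: split_indicator)
      also have "\<dots> \<le> indicator {-(5*r)..5*r} t / (r / 2)"
        using Xn r by (intro divide_left_mono) auto
      finally have "\<phi> (t / X (n + N)) / X (n + N) \<le> 2 / r * indicator {-(5*r)..5*r} t"
        by (simp add: mult.commute)
      then have "cmod (g (par_point x t)) * (\<phi> (t / X (n + N)) / X (n + N))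
          \<le> cmod (g (par_point x t)) * (2 / r * indicator {-(5*r)..5*r} t)"
        by (rule mult_left_mono) simp
      then show "norm (g (par_point x t) * complex_of_real (\<phi> (t / X (n + N)) / X (n + N))) \<le> w t"
        unfolding norm_mult norm_of_real abs_of_nonneg[OF bump_scaled_bounds(1)[OF \<phi> Xn(3)]]
        by (simp add: w_def mult_ac)
    qed
  qed measurable
  then show ?thesis
    by (rule LIMSEQ_offset)
qed

text \<open>Continuity of the averages in \<open>r\<close> makes the supremum countable, which
  yields measurability of the maximal function.\<close>

lemma M_par_eq_SUP_rat:
  assumes \<phi>: "bump \<phi>" and g: "g \<in> borel_measurable borel"
    and loc: "par_loc_integrable (\<lambda>y. ennreal (cmod (g y))) x"
  shows "M_par \<phi> g x = (SUP r\<in>\<rat> \<inter> {0<..}. ereal (cmod (A_par \<phi> r g x)))" (is "_ = ?S")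
proof (rule antisym)
  show "M_par \<phi> g x \<le> ?S"
    unfolding M_par_def
  proof (rule SUP_least)
    fix r :: real assume "r \<in> {0<..}"
    then have r: "0 < r" by simp
    \<comment> \<open>Approximation from above keeps the rationals positive and so inside the index
      set.\<close>
    have "\<exists>q\<in>\<rat>. r < q \<and> q < r + 1 / Suc n" for n
      by (rule Rats_dense_in_real) simp
    then obtain X where X: "\<And>n. X n \<in> \<rat>" "\<And>n. r < X n" "\<And>n. X n < r + 1 / Suc n"
      by metis
    have "(\<lambda>n. r + 1 / Suc n) \<longlonglongrightarrow> r + 0"
      by (intro tendsto_add tendsto_const LIMSEQ_Suc[OF lim_1_over_n])
    then have "X \<longlonglongrightarrow> r"
      using X by (intro tendsto_sandwich[of "\<lambda>_. r" X sequentially "\<lambda>n. r + 1 / Suc n"])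
        (auto intro!: always_eventually less_imp_le)
    then have "(\<lambda>n. ereal (cmod (A_par \<phi> (X n) g x))) \<longlonglongrightarrow> ereal (cmod (A_par \<phi> r g x))"
      by (intro tendsto_ereal tendsto_norm tendsto_A_par[OF \<phi> r g loc])
    moreover have "ereal (cmod (A_par \<phi> (X n) g x)) \<le> ?S" for n
      using X(1,2)[of n] r by (intro SUP_upper) auto
    ultimately show "ereal (cmod (A_par \<phi> r g x)) \<le> ?S"
      using LIMSEQ_le_const2 by blast
  qed
  show "?S \<le> M_par \<phi> g x"
    unfolding M_par_def by (rule SUP_subset_mono) auto
qed

lemma borel_measurable_A_par:
  assumes \<phi>: "bump \<phi>" and g [measurable]: "g \<in> borel_measurable borel"
  shows "(\<lambda>x. A_par \<phi> r g x) \<in> borel_measurable borel"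
proof -
  note [measurable] = borel_measurable_bump[OF \<phi>]
  show ?thesis
    unfolding A_par_borel[OF \<phi> g] by (rule lborel.borel_measurable_lebesgue_integral) measurable
qed

lemma borel_measurable_M_par:
  assumes \<phi>: "bump \<phi>" and g: "g \<in> borel_measurable borel" and ae: "AE y in lborel. f y = g y"
    and loc: "AE x in lborel. par_loc_integrable (\<lambda>y. ennreal (cmod (g y))) x"
  shows "M_par \<phi> f \<in> borel_measurable lebesgue"
proof (rule measurable_completion_cong_AE)
  show "(\<lambda>x. SUP r\<in>\<rat> \<inter> {0<..}. ereal (cmod (A_par \<phi> r g x))) \<in> borel_measurable lborel"
    using borel_measurable_A_par[OF \<phi> g]
    by (intro borel_measurable_SUP) (auto intro: countable_Int1 countable_rat)
  show "AE x in lborel. M_par \<phi> f x = (SUP r\<in>\<rat> \<inter> {0<..}. ereal (cmod (A_par \<phi> r g x)))"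
    using AE_A_par_cong[OF \<phi> g ae] loc
    by eventually_elim (simp add: M_par_def flip: M_par_eq_SUP_rat[OF \<phi> g])
qed auto

subsection \<open>Reduction to Borel representatives\<close>

text \<open>The size bound of an atom is an essential bound. A Borel representative is set to 0 off
  the box and where it exceeds the bound; this alters it on a null set and makes both properties
  hold at every point, hence on every slice.\<close>

lemma par_atomE:
  assumes a: "par_atom p N z \<rho> a" and \<rho>: "0 < \<rho>"
  obtains b where "b \<in> borel_measurable borel" "AE y in lborel. a y = b y"
    "\<And>y. cmod (b y) \<le> (4 * \<rho> ^ 3) powr (- 1 / p)" "\<And>y. y \<notin> pbox z \<rho> \<Longrightarrow> b y = 0"
proof -
  define M where "M = (4 * \<rho> ^ 3) powr (- 1 / p)"
  have "a \<in> borel_measurable (completion lborel)"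
    using a by (simp add: par_atom_def)
  then obtain b where [measurable]: "b \<in> borel_measurable lborel" and ae: "AE y in lborel. a y = b y"
    by (rule completion_ex_borel_measurable_complex)
  define b' where "b' y = (if y \<in> pbox z \<rho> \<and> cmod (b y) \<le> M then b y else 0)" for y
  have supp: "a y = 0" if "y \<notin> pbox z \<rho>" for y
    using a that closure_subset[of "support_on UNIV a"] by (auto simp: par_atom_def support_on_def)
  have "AE y in lebesgue. cmod (a y) \<le> M"
    using a unfolding par_atom_def M_def measure_pbox[OF less_imp_le[OF \<rho>]] by blast
  then have "AE y in lborel. cmod (a y) \<le> M"
    by (simp add: AE_completion_iff)
  with ae have "AE y in lborel. a y = b' y"
    by eventually_elim (use supp in \<open>auto simp: b'_def\<close>)
  moreover have "b' \<in> borel_measurable borel"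
    unfolding b'_def by measurable
  ultimately show ?thesis
    by (intro that[of b']) (auto simp: b'_def M_def)
qed

text \<open>Local integrability gives measurability of the truncations to compact boxes, and at each
  point these are eventually equal to \<open>f\<close>.\<close>

lemma borel_measurable_L1_loc:
  assumes "f \<in> L1_loc"
  shows "f \<in> borel_measurable lebesgue"
proof (rule borel_measurable_LIMSEQ_metric)
  fix n
  have "set_integrable lebesgue (sq_box n) f"
    using assms by (auto simp: L1_loc_def)
  then show "(\<lambda>x. indicator (sq_box n) x *\<^sub>R f x) \<in> borel_measurable lebesgue"
    unfolding set_integrable_def by (rule borel_measurable_integrable)
next
  fix x :: "real \<times> real"
  obtain m where m: "x \<in> sq_box m" "0 \<le> real m"
    by (rule ex_sq_box)
  have "indicator (sq_box n) x *\<^sub>R f x = f x" if n: "m \<le> n" for n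
    using m of_nat_mono[OF n, where 'a = real] by (auto simp: cbox_Pair_eq mem_Times_iff indicator_def)
  then have "eventually (\<lambda>n. f x = indicator (sq_box n) x *\<^sub>R f x) sequentially"
    unfolding eventually_sequentially by metis
  then show "(\<lambda>n. indicator (sq_box n) x *\<^sub>R f x) \<longlonglongrightarrow> f x"
    by (rule Lim_transform_eventually[OF tendsto_const])
qed

lemma nn_integral_L1_loc_finite:
  assumes f: "f \<in> L1_loc" and ae: "AE y in lborel. f y = g y"
  shows "(\<integral>\<^sup>+x. ennreal (cmod (g x)) * indicator (sq_box n) x \<partial>lborel) < \<infinity>"
proof -
  have "integrable lebesgue (\<lambda>x. indicator (sq_box n) x *\<^sub>R f x)"
    using f by (auto simp: L1_loc_def set_integrable_def)
  then have "(\<integral>\<^sup>+x. ennreal (norm (indicator (sq_box n) x *\<^sub>R f x)) \<partial>lborel) < \<infinity>"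
    by (simp add: integrable_iff_bounded nn_integral_completion)
  also have "(\<integral>\<^sup>+x. ennreal (norm (indicator (sq_box n) x *\<^sub>R f x)) \<partial>lborel)
      = (\<integral>\<^sup>+x. ennreal (cmod (g x)) * indicator (sq_box n) x \<partial>lborel)"
  proof (rule nn_integral_cong_AE)
    show "AE x in lborel. ennreal (norm (indicator (sq_box n) x *\<^sub>R f x)) = ennreal (cmod (g x)) * indicator (sq_box n) x"
      using ae by eventually_elim (auto split: split_indicator)
  qed
  finally show ?thesis .
qed

text \<open>Brings the convergence in \<open>atomic_rep\<close>, stated with Bochner integrals over
  \<open>lebesgue\<close>, into the \<open>ennreal\<close> form that Tonelli handles. Finiteness
  rules out the default value 0 of the Bochner integral.\<close>

lemma nn_integral_eq_set_integral_AE: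
  fixes D E :: "'a::euclidean_space \<Rightarrow> complex"
  assumes [measurable]: "E \<in> borel_measurable borel" "K \<in> sets borel"
    and ae: "AE x in lborel. D x = E x"
    and fin: "(\<integral>\<^sup>+x. ennreal (cmod (E x)) * indicator K x \<partial>lborel) < \<infinity>"
  shows "(\<integral>\<^sup>+x. ennreal (cmod (E x)) * indicator K x \<partial>lborel) = ennreal (LINT x:K|lebesgue. cmod (D x))"
proof -
  let ?E = "\<lambda>x. indicator K x *\<^sub>R cmod (E x)" and ?D = "\<lambda>x. indicator K x *\<^sub>R cmod (D x)"
  have m: "?E \<in> borel_measurable lborel"
    by measurable
  have eq: "AE x in lborel. ?D x = ?E x"
    using ae by eventually_elim simp
  have nn: "(\<integral>\<^sup>+x. ennreal (?E x) \<partial>lborel) = (\<integral>\<^sup>+x. ennreal (cmod (E x)) * indicator K x \<partial>lborel)"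
    by (intro nn_integral_cong) (auto split: split_indicator)
  have "integral\<^sup>L lebesgue ?D = integral\<^sup>L lebesgue ?E"
  proof (rule integral_cong_AE)
    show "?D \<in> borel_measurable lebesgue"
      by (rule measurable_completion_cong_AE[OF m eq]) auto
  qed (use m eq in \<open>auto intro: measurable_completion AE_completion\<close>)
  also have "\<dots> = integral\<^sup>L lborel ?E"
    by (rule integral_completion[OF m])
  finally have "(LINT x:K|lebesgue. cmod (D x)) = integral\<^sup>L lborel ?E"
    by (simp add: set_lebesgue_integral_def)
  moreover have "integrable lborel ?E"
    using fin unfolding nn[symmetric] by (intro integrableI_nonneg[OF m]) auto
  then have "(\<integral>\<^sup>+x. ennreal (?E x) \<partial>lborel) = ennreal (integral\<^sup>L lborel ?E)"
    by (rule nn_integral_eq_integral) auto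
  ultimately show ?thesis
    unfolding nn by (simp only:)
qed

lemma nn_integral_diff_sum_finite:
  fixes g :: "real \<times> real \<Rightarrow> complex"
  assumes [measurable]: "g \<in> borel_measurable borel"
    and fin: "(\<integral>\<^sup>+x. ennreal (cmod (g x)) * indicator (sq_box m) x \<partial>lborel) < \<infinity>"
    and bM: "\<And>i y. cmod (b i y) \<le> M i"
  shows "(\<integral>\<^sup>+x. ennreal (cmod (g x - (\<Sum>i<n. c i * b i x))) * indicator (sq_box m) x \<partial>lborel) < \<infinity>"
proof -
  define C where "C = (\<Sum>i<n. cmod (c i) * M i)"
  have "cmod (\<Sum>i<n. c i * b i x) \<le> C" for x
    unfolding C_def by (intro sum_norm_le) (auto simp: norm_mult intro!: mult_left_mono bM)
  then have "cmod (g x - (\<Sum>i<n. c i * b i x)) \<le> cmod (g x) + C" for x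
    by (metis add_left_mono norm_triangle_ineq4 order_trans)
  moreover have C: "0 \<le> C"
    using \<open>\<And>x. cmod (\<Sum>i<n. c i * b i x) \<le> C\<close> norm_ge_zero order_trans by blast
  ultimately have "ennreal (cmod (g x - (\<Sum>i<n. c i * b i x))) \<le> ennreal (cmod (g x)) + ennreal C" for x
    unfolding ennreal_plus[OF norm_ge_zero C, symmetric] by (intro ennreal_leI) blast
  then have "(\<integral>\<^sup>+x. ennreal (cmod (g x - (\<Sum>i<n. c i * b i x))) * indicator (sq_box m) x \<partial>lborel)
      \<le> (\<integral>\<^sup>+x. (ennreal (cmod (g x)) + ennreal C) * indicator (sq_box m) x \<partial>lborel)"
    by (intro nn_integral_mono mult_right_mono) auto
  also have "\<dots> = (\<integral>\<^sup>+x. ennreal (cmod (g x)) * indicator (sq_box m) x \<partial>lborel)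
      + ennreal C * emeasure lborel (sq_box m)"
    unfolding distrib_right by (subst nn_integral_add) (auto simp: nn_integral_cmult)
  also have "\<dots> < \<infinity>"
    using fin emeasure_lborel_cbox_finite[of "(- real m, - real m)" "(real m, real m)"]
    by (simp add: ennreal_mult_less_top)
  finally show ?thesis .
qed

subsection \<open>Pointwise domination by the averages of the atoms\<close>

text \<open>By linearity for finite sums, |A_r g| is at most the average of the remainder plus a
  partial sum of the right side. The former is at most 1/r times the integral of the remainder over
  |t| \<le> 5r/2, which tends to 0 along \<open>n\<close>. The right side may be infinite.\<close>

lemma A_par_le_suminf:
  assumes \<phi>: "bump \<phi>" and r: "0 < r"
    and g [measurable]: "g \<in> borel_measurable borel" and loc: "par_loc_integrable (\<lambda>y. ennreal (cmod (g y))) x"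
    and b [measurable]: "\<And>i. b i \<in> borel_measurable borel" and bM: "\<And>i y. cmod (b i y) \<le> M i"
    and conv: "\<And>T. (\<lambda>k. \<integral>\<^sup>+t. ennreal (cmod (g (par_point x t) - (\<Sum>i<n k. c i * b i (par_point x t))))
      * indicator {-T..T} t \<partial>lborel) \<longlonglongrightarrow> 0"
  shows "ennreal (cmod (A_par \<phi> r g x)) \<le> (\<Sum>i. ennreal (cmod (c i) * cmod (A_par \<phi> r (b i) x)))"
proof -
  define S where "S = (\<Sum>i. ennreal (cmod (c i) * cmod (A_par \<phi> r (b i) x)))"
  define T where "T = 5 * r / 2"
  define E where "E k y = g y - (\<Sum>i<n k. c i * b i y)" for k y
  have E [measurable]: "E k \<in> borel_measurable borel" for k
    unfolding E_def by measurable
  define e where "e k = (\<integral>\<^sup>+t. ennreal (cmod (E k (par_point x t))) * indicator {-T..T} t \<partial>lborel)" for k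
  have le: "ennreal (cmod (A_par \<phi> r g x)) \<le> ennreal (1 / r) * e k + S" for k
  proof -
    let ?w = "\<lambda>t. complex_of_real (\<phi> (t / r) / r)"
    \<comment> \<open>Splitting the Bochner integral requires integrable slices: for
      \<open>g\<close> by the choice of \<open>x\<close>, for the atoms by boundedness.\<close>
    have int_g: "integrable lborel (\<lambda>t. g (par_point x t) * ?w t)"
      by (rule integrable_par_point_bump[OF \<phi> r g loc])
    have int_b: "integrable lborel (\<lambda>t. b i (par_point x t) * ?w t)" for i
      by (rule integrable_par_point_bump[OF \<phi> r b par_loc_integrable_bounded[OF bM]])
    have "A_par \<phi> r (E k) x
        = (LINT t|lborel. g (par_point x t) * ?w t - (\<Sum>i<n k. c i * (b i (par_point x t) * ?w t)))"
      unfolding A_par_borel[OF \<phi> E]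
      by (rule Bochner_Integration.integral_cong) (simp_all only: E_def left_diff_distrib sum_distrib_right mult.assoc)
    also have "\<dots> = A_par \<phi> r g x - (\<Sum>i<n k. c i * A_par \<phi> r (b i) x)"
      unfolding A_par_borel[OF \<phi> g] A_par_borel[OF \<phi> b]
      by (simp only: Bochner_Integration.integral_diff[OF int_g Bochner_Integration.integrable_sum[OF integrable_mult_right[OF int_b]]]
          Bochner_Integration.integral_sum[OF integrable_mult_right[OF int_b]] integral_mult_right_zero)
    finally have "A_par \<phi> r g x = A_par \<phi> r (E k) x + (\<Sum>i<n k. c i * A_par \<phi> r (b i) x)"
      by simp
    then have "cmod (A_par \<phi> r g x) \<le> cmod (A_par \<phi> r (E k) x) + (\<Sum>i<n k. cmod (c i) * cmod (A_par \<phi> r (b i) x))"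
      by (auto simp: norm_mult intro!: order_trans[OF norm_triangle_ineq] add_left_mono sum_norm_le)
    then have "ennreal (cmod (A_par \<phi> r g x))
        \<le> ennreal (cmod (A_par \<phi> r (E k) x)) + ennreal (\<Sum>i<n k. cmod (c i) * cmod (A_par \<phi> r (b i) x))"
      by (subst ennreal_plus[symmetric]) (auto intro!: ennreal_leI sum_nonneg)
    also have "\<dots> \<le> ennreal (1 / r) * e k + S"
    proof (rule add_mono)
      have "ennreal (cmod (A_par \<phi> r (E k) x))
          \<le> (\<integral>\<^sup>+t. ennreal (cmod (E k (par_point x t))) * ennreal (indicator {r/2<..<5*r/2} t / r) \<partial>lborel)"
        by (rule cmod_A_par_le[OF \<phi> E r])
      also have "\<dots> \<le> (\<integral>\<^sup>+t. ennreal (cmod (E k (par_point x t))) * (ennreal (1 / r) * indicator {-T..T} t) \<partial>lborel)"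
        by (intro nn_integral_mono mult_left_mono indicator_Ioo_le_Icc[OF r]) (simp_all add: T_def)
      also have "\<dots> = ennreal (1 / r) * e k"
        unfolding e_def by (subst nn_integral_cmult[symmetric]) (auto simp: mult_ac)
      finally show "ennreal (cmod (A_par \<phi> r (E k) x)) \<le> ennreal (1 / r) * e k" .
      show "ennreal (\<Sum>i<n k. cmod (c i) * cmod (A_par \<phi> r (b i) x)) \<le> S"
        unfolding S_def
        by (subst sum_ennreal[symmetric]) (auto intro!: sum_le_suminf simp del: sum_ennreal)
    qed
    finally show ?thesis .
  qed
  have "e \<longlonglongrightarrow> 0"
    unfolding e_def E_def by (rule conv)
  then have "(\<lambda>k. ennreal (1 / r) * e k + S) \<longlonglongrightarrow> ennreal (1 / r) * 0 + S"
    by (intro tendsto_add ennreal_tendsto_cmult tendsto_const) auto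
  then have "(\<lambda>k. ennreal (1 / r) * e k + S) \<longlonglongrightarrow> S"
    by simp
  then have "ennreal (cmod (A_par \<phi> r g x)) \<le> S"
    using le LIMSEQ_le_const by blast
  then show ?thesis
    by (simp add: S_def)
qed

lemma ennreal_le_suminf: "f k \<le> (\<Sum>i. f i)" for f :: "nat \<Rightarrow> ennreal"
  using sum_le_suminf[of f "{k}"] by simp

text \<open>Either one term reaches \<open>\<alpha>\<close> and its truncation is already 1, or no
  term is truncated and the sum exceeds 1 after division by \<open>\<alpha>\<close>. The truncation
  caps the weight that a large term needs in the cover.\<close>

lemma one_le_suminf_min:
  fixes v :: "nat \<Rightarrow> real"
  assumes \<alpha>: "0 < \<alpha>" and v: "\<And>i. 0 \<le> v i" and less: "ennreal \<alpha> < (\<Sum>i. ennreal (v i))"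
  shows "1 \<le> (\<Sum>i. ennreal (min 1 (v i / \<alpha>)))"
proof (cases "\<exists>j. \<alpha> \<le> v j")
  case True
  then obtain j where j: "\<alpha> \<le> v j" ..
  then have "min 1 (v j / \<alpha>) = 1"
    using \<alpha> by (simp add: min_def field_simps)
  then have "1 = ennreal (min 1 (v j / \<alpha>))"
    by simp
  also have "\<dots> \<le> (\<Sum>i. ennreal (min 1 (v i / \<alpha>)))"
    by (rule ennreal_le_suminf)
  finally show ?thesis .
next
  case False
  have eq: "ennreal (min 1 (v i / \<alpha>)) = ennreal (1 / \<alpha>) * ennreal (v i)" for i
  proof -
    have "min 1 (v i / \<alpha>) = 1 / \<alpha> * v i"
      using False[unfolded not_ex, THEN spec, of i] \<alpha> by (simp add: min_def field_simps)
    then show ?thesis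
      using \<alpha> v[of i] by (simp only:) (rule ennreal_mult, auto)
  qed
  have "1 = ennreal (1 / \<alpha>) * ennreal \<alpha>"
    using \<alpha> by (subst ennreal_mult[symmetric]) auto
  also have "\<dots> \<le> ennreal (1 / \<alpha>) * (\<Sum>i. ennreal (v i))"
    using less by (intro mult_left_mono) auto
  also have "\<dots> = (\<Sum>i. ennreal (min 1 (v i / \<alpha>)))"
    unfolding eq by (rule ennreal_suminf_cmult[symmetric])
  finally show ?thesis .
qed

subsection \<open>The weak-type estimate\<close>

text \<open>A cover is a single sequence, so the doubly indexed family is enumerated by
  \<open>prod_decode\<close>; sums in \<open>ennreal\<close> may be rearranged freely.\<close>

lemma tendril_content_le:
  fixes \<theta> R :: "nat \<Rightarrow> nat \<Rightarrow> real" and \<rho> :: "nat \<Rightarrow> real"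
  assumes "\<And>i k. 0 \<le> \<theta> i k" "\<And>i. 0 < \<rho> i" "\<And>i k. \<rho> i \<le> R i k"
    and cov: "AE x in lborel. x \<in> E \<longrightarrow>
      1 \<le> (\<Sum>i. \<Sum>k. ennreal (\<theta> i k) * indicator (tendril (z i) (\<rho> i) (R i k)) x)"
  shows "tendril_content p E \<le> (\<Sum>i. \<Sum>k. ennreal (\<theta> i k * \<rho> i * R i k powr (2 * p)))"
proof -
  define \<theta>' where "\<theta>' n = case_prod \<theta> (prod_decode n)" for n
  define \<rho>' where "\<rho>' n = \<rho> (fst (prod_decode n))" for n
  define z' where "z' n = z (fst (prod_decode n))" for n
  define R' where "R' n = case_prod R (prod_decode n)" for n
  note defs = \<theta>'_def \<rho>'_def z'_def R'_def
  have sum1: "(\<Sum>n. ennreal (\<theta>' n) * indicator (tendril (z' n) (\<rho>' n) (R' n)) x)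
      = (\<Sum>i. \<Sum>k. ennreal (\<theta> i k) * indicator (tendril (z i) (\<rho> i) (R i k)) x)" for x
    using suminf_ennreal_2dimen[of _ "\<lambda>(i, k). ennreal (\<theta> i k) * indicator (tendril (z i) (\<rho> i) (R i k)) x"]
    by (simp add: defs split_def)
  have sum2: "(\<Sum>n. ennreal (\<theta>' n * \<rho>' n * R' n powr (2 * p)))
      = (\<Sum>i. \<Sum>k. ennreal (\<theta> i k * \<rho> i * R i k powr (2 * p)))"
    using suminf_ennreal_2dimen[of _ "\<lambda>(i, k). ennreal (\<theta> i k * \<rho> i * R i k powr (2 * p))"]
    by (simp add: defs split_def)
  have "AE x in lborel. indicator E x \<le> (\<Sum>n. ennreal (\<theta>' n) * indicator (tendril (z' n) (\<rho>' n) (R' n)) x)"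
    unfolding sum1 using cov by eventually_elim (auto split: split_indicator)
  then have "tendril_cover E \<theta>' z' \<rho>' R'"
    unfolding tendril_cover_def AE_completion_iff using assms by (auto simp: defs split_def)
  then show ?thesis
    unfolding tendril_content_def sum2[symmetric] by (intro Inf_lower) blast
qed

text \<open>The p-th power of |Q|^(-1/p) is 1/|Q| = rho^(-3)/4. Against the tendril cost rho^(1+2p)
  this leaves rho^(2p-2), the power in the scale cost.\<close>

lemma powr_atom_size:
  fixes \<rho> c \<alpha> p :: real
  assumes p: "0 < p" "p < 1" and \<rho>: "0 < \<rho>" and \<alpha>: "0 < \<alpha>" and c: "0 \<le> c"
  shows "(4 * (4 * \<rho> ^ 3) powr (- 1 / p) * c / \<alpha>) powr p * \<rho> powr (1 + 2 * p)
    \<le> 4 powr (p - 1) * \<alpha> powr (- p) * (c powr p * scale_cost p \<rho>)"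
proof -
  define M where "M = (4 * \<rho> ^ 3) powr (- 1 / p)"
  have "M powr p = (4 * \<rho> ^ 3) powr (- 1)"
    unfolding M_def powr_powr using p by simp
  also have "\<dots> = inverse 4 * \<rho> powr (- 3)"
    using \<rho> by (simp add: powr_minus powr_numeral)
  finally have M: "M powr p = inverse 4 * \<rho> powr (- 3)" .
  have "(4 * M * c / \<alpha>) powr p * \<rho> powr (1 + 2 * p)
      = 4 powr p * (inverse 4 * \<rho> powr (- 3)) * c powr p / \<alpha> powr p * \<rho> powr (1 + 2 * p)"
    using \<alpha> c by (simp add: powr_divide powr_mult M)
  also have "\<dots> = (4 powr p / 4) * \<alpha> powr (- p) * (c powr p * (\<rho> powr (- 3) * \<rho> powr (1 + 2 * p)))"
    by (simp add: powr_minus field_simps)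
  also have "4 powr p / 4 = 4 powr (p - 1)"
    by (simp add: powr_diff)
  also have "\<rho> powr (- 3) * \<rho> powr (1 + 2 * p) = \<rho> powr (2 * p - 2)"
    by (simp flip: powr_add)
  \<comment> \<open>The exponent 2p - 2 is negative, so replacing rho by min 1 rho can only increase
    the power.\<close>
  also have "\<dots> \<le> scale_cost p \<rho>"
    unfolding scale_cost_def using p \<rho> by (intro powr_mono2') auto
  finally show ?thesis
    using c by (simp add: M_def mult_left_mono)
qed

text \<open>The quotient comes from the geometric series of tendrils, the last factor from the size
  of an atom.\<close>

definition weak_type_const :: "real \<Rightarrow> real" where
  "weak_type_const p = 25 / (1 - 4 powr (p - 1)) * 4 powr (p - 1)"

lemma weak_type_const_pos:
  assumes "p < 1"
  shows "0 < weak_type_const p"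
proof -
  have "4 powr (p - 1) < (1 :: real)"
    using assms by (intro powr_less_one) auto
  then show ?thesis
    by (simp add: weak_type_const_def)
qed

text \<open>Since \<open>p < 1\<close>, the tendril of length \<open>2^k * s\<close> may enter with weight \<open>4^(-k)\<close>: this gives a
  fractional cover by all atoms simultaneously, although the level sets of a sum are not covered
  by level sets of the summands.\<close>
lemma tendril_content_level_set:
  assumes \<phi>: "bump \<phi>" and p: "0 < p" "p < 1" and \<alpha>: "0 < \<alpha>"
    and b: "\<And>i. b i \<in> borel_measurable borel" and \<rho>: "\<And>i. 0 < \<rho> i"
    and bM: "\<And>i y. cmod (b i y) \<le> (4 * \<rho> i ^ 3) powr (- 1 / p)"
    and supp: "\<And>i y. y \<notin> pbox (z i) (\<rho> i) \<Longrightarrow> b i y = 0"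
    and S: "summable (\<lambda>i. cmod (c i) powr p * scale_cost p (\<rho> i))"
    and E: "AE x in lborel. x \<in> E \<longrightarrow>
      (\<exists>r>0. ennreal \<alpha> < (\<Sum>i. ennreal (cmod (c i) * cmod (A_par \<phi> r (b i) x))))"
  shows "tendril_content p E
    \<le> ennreal (weak_type_const p * \<alpha> powr (- p) * (\<Sum>i. cmod (c i) powr p * scale_cost p (\<rho> i)))"
proof -
  \<comment> \<open>Up to division by \<open>\<alpha>\<close>, this bounds the i-th term at radii r
    \<le> rho; for larger r it is multiplied by (rho/r)^2.\<close>
  define \<beta> where "\<beta> i = 4 * (4 * \<rho> i ^ 3) powr (- 1 / p) * cmod (c i) / \<alpha>" for i
  define \<theta> where "\<theta> i k = 25 * min 1 (\<beta> i) / 4 ^ k" for i k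
  define R where "R i k = 2 ^ k * max 1 (sqrt (\<beta> i)) * \<rho> i" for i k
  have \<beta>: "0 \<le> \<beta> i" for i
    using \<alpha> by (simp add: \<beta>_def)
  \<comment> \<open>The right side is free of \<open>r\<close>, so below \<open>r\<close> may depend
    on \<open>x\<close>.\<close>
  have summand: "ennreal (min 1 (cmod (c i) * cmod (A_par \<phi> r (b i) x) / \<alpha>))
      \<le> (\<Sum>k. ennreal (\<theta> i k) * indicator (tendril (z i) (\<rho> i) (R i k)) x)" if r: "0 < r" for i r x
  proof -
    define v where "v = cmod (c i) * cmod (A_par \<phi> r (b i) x) / \<alpha>"
    have "\<exists>k. min 1 v \<le> 25 * min 1 (\<beta> i) / 4 ^ k
        * indicator (tendril (z i) (\<rho> i) (2 ^ k * max 1 (sqrt (\<beta> i)) * \<rho> i)) x"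
    proof (rule ex_tendril_scale[OF \<rho> r \<beta>])
      show "0 \<le> v"
        using \<alpha> by (simp add: v_def)
      have "cmod (A_par \<phi> r (b i) x) \<le> 4 * (4 * \<rho> i ^ 3) powr (- 1 / p) * min 1 ((\<rho> i / r)\<^sup>2)"
        by (rule cmod_A_par_pbox_le[OF \<phi> b r _ bM supp]) auto
      then have "cmod (c i) / \<alpha> * cmod (A_par \<phi> r (b i) x)
          \<le> cmod (c i) / \<alpha> * (4 * (4 * \<rho> i ^ 3) powr (- 1 / p) * min 1 ((\<rho> i / r)\<^sup>2))"
        using \<alpha> by (intro mult_left_mono) auto
      then show "v \<le> \<beta> i * min 1 ((\<rho> i / r)\<^sup>2)"
        by (simp add: v_def \<beta>_def mult_ac)
      show "x \<in> tendril (z i) (\<rho> i) R'" if "v \<noteq> 0" "5 * r / 2 \<le> R'" for R'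
        using that by (intro A_par_nonzero_imp_mem_tendril[OF \<phi> b r supp _ _ \<rho>]) (auto simp: v_def)
    qed
    then obtain k where k: "min 1 v \<le> \<theta> i k * indicator (tendril (z i) (\<rho> i) (R i k)) x"
      by (auto simp: \<theta>_def R_def)
    have "0 \<le> \<theta> i k"
      using \<beta> by (simp add: \<theta>_def)
    then have "ennreal (min 1 v) \<le> ennreal (\<theta> i k) * indicator (tendril (z i) (\<rho> i) (R i k)) x"
      using ennreal_leI[OF k] by (simp add: ennreal_mult ennreal_indicator)
    also have "\<dots> \<le> (\<Sum>k. ennreal (\<theta> i k) * indicator (tendril (z i) (\<rho> i) (R i k)) x)"
      by (rule ennreal_le_suminf)
    finally show ?thesis
      by (simp only: v_def)
  qed
  have "tendril_content p E \<le> (\<Sum>i. \<Sum>k. ennreal (\<theta> i k * \<rho> i * R i k powr (2 * p)))"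
  proof (rule tendril_content_le[where z = z])
    show "0 \<le> \<theta> i k" for i k
      using \<beta> by (simp add: \<theta>_def)
    show "\<rho> i \<le> R i k" for i k
    proof -
      have "1 * 1 \<le> 2 ^ k * max 1 (sqrt (\<beta> i))"
        by (intro mult_mono) auto
      then have "1 * \<rho> i \<le> 2 ^ k * max 1 (sqrt (\<beta> i)) * \<rho> i"
        using \<rho>[of i] by (intro mult_right_mono) auto
      then show ?thesis by (simp add: R_def)
    qed
    show "AE x in lborel. x \<in> E \<longrightarrow>
      1 \<le> (\<Sum>i. \<Sum>k. ennreal (\<theta> i k) * indicator (tendril (z i) (\<rho> i) (R i k)) x)"
      using E
    proof eventually_elim
      case (elim x)
      show ?case
      proof
        assume "x \<in> E"
        then obtain r where r: "0 < r"
          and less: "ennreal \<alpha> < (\<Sum>i. ennreal (cmod (c i) * cmod (A_par \<phi> r (b i) x)))"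
          using elim by blast
        have "1 \<le> (\<Sum>i. ennreal (min 1 (cmod (c i) * cmod (A_par \<phi> r (b i) x) / \<alpha>)))"
          by (rule one_le_suminf_min[OF \<alpha> _ less]) simp
        also have "\<dots> \<le> (\<Sum>i. \<Sum>k. ennreal (\<theta> i k) * indicator (tendril (z i) (\<rho> i) (R i k)) x)"
          by (intro suminf_le summand r) auto
        finally show "1 \<le> (\<Sum>i. \<Sum>k. ennreal (\<theta> i k) * indicator (tendril (z i) (\<rho> i) (R i k)) x)" .
      qed
    qed
  qed (rule \<rho>)
  also have "\<dots> \<le> (\<Sum>i. ennreal (weak_type_const p * \<alpha> powr (- p) * (cmod (c i) powr p * scale_cost p (\<rho> i))))"
  proof (intro suminf_le)
    fix i
    have q: "4 powr (p - 1) < (1 :: real)"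
      using p by (intro powr_less_one) auto
    have "(\<Sum>k. ennreal (\<theta> i k * \<rho> i * R i k powr (2 * p)))
        \<le> ennreal (25 / (1 - 4 powr (p - 1)) * (\<beta> i powr p * \<rho> i powr (1 + 2 * p)))"
      unfolding \<theta>_def R_def by (rule suminf_tendril_cost[OF p \<rho> \<beta>])
    also have "\<dots> \<le> ennreal (25 / (1 - 4 powr (p - 1))
        * (4 powr (p - 1) * \<alpha> powr (- p) * (cmod (c i) powr p * scale_cost p (\<rho> i))))"
      unfolding \<beta>_def using q by (intro ennreal_leI mult_left_mono powr_atom_size p \<rho> \<alpha>) auto
    finally show "(\<Sum>k. ennreal (\<theta> i k * \<rho> i * R i k powr (2 * p)))
        \<le> ennreal (weak_type_const p * \<alpha> powr (- p) * (cmod (c i) powr p * scale_cost p (\<rho> i)))"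
      by (simp add: weak_type_const_def mult_ac)
  qed auto
  also have "\<dots> = ennreal (\<Sum>i. weak_type_const p * \<alpha> powr (- p) * (cmod (c i) powr p * scale_cost p (\<rho> i)))"
    using weak_type_const_pos[OF p(2)]
    by (intro suminf_ennreal2 summable_mult S) (auto simp: scale_cost_def)
  also have "(\<Sum>i. weak_type_const p * \<alpha> powr (- p) * (cmod (c i) powr p * scale_cost p (\<rho> i)))
      = weak_type_const p * \<alpha> powr (- p) * (\<Sum>i. cmod (c i) powr p * scale_cost p (\<rho> i))"
    by (rule suminf_mult[OF S])
  finally show ?thesis .
qed

text \<open>A diagonal choice: \<open>n k\<close> makes the error on \<open>sq_box k\<close> smaller
  than 2^(-k). The errors are summable while the boxes exhaust the plane, which turns convergence in
  \<open>L1_loc\<close> into convergence along almost every parabola.\<close>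

lemma atomic_rep_AE_A_par_le:
  assumes \<phi>: "bump \<phi>" and f: "f \<in> L1_loc" and rep: "atomic_rep p N f c a z \<rho>"
    and g [measurable]: "g \<in> borel_measurable borel" and fg: "AE y in lborel. f y = g y"
    and b [measurable]: "\<And>i. b i \<in> borel_measurable borel" and ab: "\<And>i. AE y in lborel. a i y = b i y"
    and bM: "\<And>i y. cmod (b i y) \<le> M i"
  shows "AE x in lborel. \<forall>r>0.
    ennreal (cmod (A_par \<phi> r f x)) \<le> (\<Sum>i. ennreal (cmod (c i) * cmod (A_par \<phi> r (b i) x)))"
proof -
  define e where "e k n = (\<integral>\<^sup>+x. ennreal (cmod (g x - (\<Sum>i<n. c i * b i x))) * indicator (sq_box k) x \<partial>lborel)"
    for k n
  have fin: "(\<integral>\<^sup>+x. ennreal (cmod (g x)) * indicator (sq_box k) x \<partial>lborel) < \<infinity>" for k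
    by (rule nn_integral_L1_loc_finite[OF f fg])
  have "AE x in lborel. \<forall>i. a i x = b i x"
    using ab by (simp add: AE_all_countable)
  with fg have diff: "AE x in lborel. f x - (\<Sum>i<n. c i * a i x) = g x - (\<Sum>i<n. c i * b i x)" for n
    by eventually_elim simp
  have e_eq: "e k n = ennreal (LINT x:sq_box k|lebesgue. cmod (f x - (\<Sum>i<n. c i * a i x)))" for k n
    unfolding e_def
    by (intro nn_integral_eq_set_integral_AE diff nn_integral_diff_sum_finite[OF g fin bM]) measurable
  have "(\<lambda>n. LINT x:sq_box k|lebesgue. cmod (f x - (\<Sum>i<n. c i * a i x))) \<longlonglongrightarrow> 0" for k
    using rep by (simp add: atomic_rep_def)
  then have "e k \<longlonglongrightarrow> ennreal 0" for k
    unfolding e_eq[abs_def] by (rule tendsto_ennrealI)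
  then have "\<exists>n. e k n < ennreal ((1/2) ^ k)" for k
    using order_tendstoD(2)[of "e k" "ennreal 0" sequentially "ennreal ((1/2) ^ k)"]
    by (auto simp: eventually_sequentially simp del: ennreal_0 simp: ennreal_less_iff)
  then obtain n where n: "\<And>k. e k (n k) < ennreal ((1/2) ^ k)"
    by metis
  have "(\<Sum>k. e k (n k)) \<le> (\<Sum>k. ennreal ((1/2) ^ k))"
    using n by (intro suminf_le) (auto intro: less_imp_le)
  also have "\<dots> = ennreal (\<Sum>k. (1/2) ^ k)"
    by (intro suminf_ennreal2) (auto simp: summable_geometric)
  finally have "(\<Sum>k. e k (n k)) < \<infinity>"
    by (simp add: le_less_trans)
  then have "AE x in lborel. \<forall>T. (\<lambda>k. \<integral>\<^sup>+t. ennreal (cmod (g (par_point x t)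
      - (\<Sum>i<n k. c i * b i (par_point x t)))) * indicator {-T..T} t \<partial>lborel) \<longlonglongrightarrow> 0"
    unfolding e_def by (intro AE_par_point_tendsto_0) measurable
  moreover have "AE x in lborel. par_loc_integrable (\<lambda>y. ennreal (cmod (g y))) x"
    by (rule AE_par_loc_integrable[OF _ fin]) measurable
  ultimately show ?thesis
    using AE_A_par_cong[OF \<phi> g fg]
  proof eventually_elim
    case (elim x)
    show ?case
    proof (intro allI impI)
      fix r :: real assume r: "0 < r"
      show "ennreal (cmod (A_par \<phi> r f x)) \<le> (\<Sum>i. ennreal (cmod (c i) * cmod (A_par \<phi> r (b i) x)))"
        using elim A_par_le_suminf[OF \<phi> r g elim(2) b bM, where n = n and c = c] by simp
    qed
  qed
qed

text \<open>The constant does not depend on the representation, which allows the infimum over all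
  representations to be taken afterwards.\<close>

lemma M_par_atomic_rep:
  assumes \<phi>: "bump \<phi>" and p: "0 < p" "p < 1" and f: "f \<in> L1_loc" and rep: "atomic_rep p N f c a z \<rho>"
  shows "M_par \<phi> f \<in> borel_measurable lebesgue"
    and "weak_tendril_sup p (M_par \<phi> f)
      \<le> ennreal (weak_type_const p * (\<Sum>i. cmod (c i) powr p * scale_cost p (\<rho> i)))"
proof -
  define S where "S = (\<Sum>i. cmod (c i) powr p * scale_cost p (\<rho> i))"
  have \<rho>: "0 < \<rho> i" and atom: "par_atom p N (z i) (\<rho> i) (a i)" for i
    using rep by (auto simp: atomic_rep_def)
  have summable: "summable (\<lambda>i. cmod (c i) powr p * scale_cost p (\<rho> i))"
    using rep by (simp add: atomic_rep_def)
  obtain g where "g \<in> borel_measurable lborel" and fg: "AE y in lborel. f y = g y"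
    using completion_ex_borel_measurable_complex[OF borel_measurable_L1_loc[OF f]] by blast
  then have g [measurable]: "g \<in> borel_measurable borel"
    by simp
  have "\<exists>b. b \<in> borel_measurable borel \<and> (AE y in lborel. a i y = b y)
      \<and> (\<forall>y. cmod (b y) \<le> (4 * \<rho> i ^ 3) powr (- 1 / p)) \<and> (\<forall>y. y \<notin> pbox (z i) (\<rho> i) \<longrightarrow> b y = 0)" for i
    by (rule par_atomE[OF atom[of i] \<rho>[of i]]) blast
  then obtain b where "\<And>i. b i \<in> borel_measurable borel \<and> (AE y in lborel. a i y = b i y)
      \<and> (\<forall>y. cmod (b i y) \<le> (4 * \<rho> i ^ 3) powr (- 1 / p)) \<and> (\<forall>y. y \<notin> pbox (z i) (\<rho> i) \<longrightarrow> b i y = 0)"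
    by moura
  then have b: "\<And>i. b i \<in> borel_measurable borel" and ab: "\<And>i. AE y in lborel. a i y = b i y"
    and bM: "\<And>i y. cmod (b i y) \<le> (4 * \<rho> i ^ 3) powr (- 1 / p)"
    and supp: "\<And>i y. y \<notin> pbox (z i) (\<rho> i) \<Longrightarrow> b i y = 0"
    by auto
  have "AE x in lborel. par_loc_integrable (\<lambda>y. ennreal (cmod (g y))) x"
    by (rule AE_par_loc_integrable[OF _ nn_integral_L1_loc_finite[OF f fg]]) measurable
  then show "M_par \<phi> f \<in> borel_measurable lebesgue"
    by (rule borel_measurable_M_par[OF \<phi> g fg])
  have "ennreal (\<alpha> powr p) * tendril_content p {x. \<bar>M_par \<phi> f x\<bar> > ereal \<alpha>}
      \<le> ennreal (weak_type_const p * S)" if \<alpha>: "0 < \<alpha>" for \<alpha>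
  proof -
    have level: "AE x in lborel. x \<in> {x. \<bar>M_par \<phi> f x\<bar> > ereal \<alpha>} \<longrightarrow>
        (\<exists>r>0. ennreal \<alpha> < (\<Sum>i. ennreal (cmod (c i) * cmod (A_par \<phi> r (b i) x))))"
      using atomic_rep_AE_A_par_le[OF \<phi> f rep g fg b ab bM]
    proof eventually_elim
      case (elim x)
      show ?case
      proof
        assume x: "x \<in> {x. \<bar>M_par \<phi> f x\<bar> > ereal \<alpha>}"
        have "0 \<le> M_par \<phi> f x"
          unfolding M_par_def by (rule SUP_upper2[of 1]) auto
        with x have "ereal \<alpha> < (SUP r\<in>{0<..}. ereal (cmod (A_par \<phi> r f x)))"
          by (simp add: M_par_def abs_ereal_pos)
        then obtain r where r: "0 < r" "\<alpha> < cmod (A_par \<phi> r f x)"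
          by (auto simp: less_SUP_iff)
        then have "ennreal \<alpha> < ennreal (cmod (A_par \<phi> r f x))"
          using \<alpha> by (simp add: ennreal_less_iff)
        also have "\<dots> \<le> (\<Sum>i. ennreal (cmod (c i) * cmod (A_par \<phi> r (b i) x)))"
          using elim r by blast
        finally show "\<exists>r>0. ennreal \<alpha> < (\<Sum>i. ennreal (cmod (c i) * cmod (A_par \<phi> r (b i) x)))"
          using r by blast
      qed
    qed
    have "tendril_content p {x. \<bar>M_par \<phi> f x\<bar> > ereal \<alpha>} \<le> ennreal (weak_type_const p * \<alpha> powr (- p) * S)"
      unfolding S_def by (rule tendril_content_level_set[OF \<phi> p \<alpha> b \<rho> bM _ summable level]) (rule supp)
    then have "ennreal (\<alpha> powr p) * tendril_content p {x. \<bar>M_par \<phi> f x\<bar> > ereal \<alpha>}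
        \<le> ennreal (\<alpha> powr p) * ennreal (weak_type_const p * \<alpha> powr (- p) * S)"
      by (rule mult_left_mono) simp
    also have "\<dots> = ennreal (weak_type_const p * S)"
      using \<alpha> by (simp add: ennreal_mult'[symmetric] powr_minus field_simps)
    finally show ?thesis .
  qed
  then show "weak_tendril_sup p (M_par \<phi> f)
      \<le> ennreal (weak_type_const p * (\<Sum>i. cmod (c i) powr p * scale_cost p (\<rho> i)))"
    unfolding weak_tendril_sup_def S_def[symmetric] by (intro SUP_least) simp
qed

theorem theorem1p8:
  fixes \<phi> :: "real \<Rightarrow> real" and p :: real and N :: nat
  assumes "bump \<phi>"
    and "0 < p" and "p < 1"
    and "0 < N" and "\<lfloor>3 * (1 / p - 1)\<rfloor> \<le> int N"
  shows "\<exists>C::real. \<forall>f\<in>H_par p N.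
           M_par \<phi> f \<in> weak_tendril_space p \<and>
           weak_tendril_norm p (M_par \<phi> f) \<le> C * H_par_norm p N f"
proof (intro exI ballI conjI)
  fix f assume "f \<in> H_par p N"
  then obtain c a z \<rho> where f: "f \<in> L1_loc" and rep: "atomic_rep p N f c a z \<rho>"
    by (auto simp: H_par_def)
  note est = M_par_atomic_rep[OF assms(1-3) f]
  let ?K = "weak_type_const p"
  have K: "0 < ?K"
    using assms by (simp add: weak_type_const_pos)
  show "M_par \<phi> f \<in> weak_tendril_space p"
    using est(1)[OF rep] est(2)[OF rep] by (auto simp: weak_tendril_space_def intro: le_less_trans)
  \<comment> \<open>Dividing by the positive constant turns the claim into a lower bound for an
    infimum, over a set that is nonempty because \<open>f\<close> has a representation.\<close>
  have "weak_tendril_norm p (M_par \<phi> f) / ?K powr (1 / p) \<le> H_par_norm p N f"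
    unfolding H_par_norm_def
  proof (rule cInf_greatest)
    fix s assume "s \<in> {(\<Sum>i. cmod (c i) powr p * scale_cost p (\<rho> i)) powr (1 / p) | c a z \<rho>. atomic_rep p N f c a z \<rho>}"
    then obtain c a z \<rho> where s: "s = (\<Sum>i. cmod (c i) powr p * scale_cost p (\<rho> i)) powr (1 / p)"
      and rep: "atomic_rep p N f c a z \<rho>" by blast
    define S where "S = (\<Sum>i. cmod (c i) powr p * scale_cost p (\<rho> i))"
    have S: "0 \<le> S"
      using rep unfolding S_def by (intro suminf_nonneg) (auto simp: atomic_rep_def scale_cost_def)
    have "enn2real (weak_tendril_sup p (M_par \<phi> f)) \<le> ?K * S"
      using est(2)[OF rep] K S by (intro enn2real_leI) (auto simp: S_def)
    then have "weak_tendril_norm p (M_par \<phi> f) \<le> (?K * S) powr (1 / p)"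
      unfolding weak_tendril_norm_def using assms by (intro powr_mono2) auto
    also have "\<dots> = ?K powr (1 / p) * s"
      using K S by (simp add: powr_mult s S_def)
    finally show "weak_tendril_norm p (M_par \<phi> f) / ?K powr (1 / p) \<le> s"
      using K by (simp add: field_simps)
  qed (use rep in blast)
  then show "weak_tendril_norm p (M_par \<phi> f) \<le> ?K powr (1 / p) * H_par_norm p N f"
    using K by (simp add: field_simps)
qed

end
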